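(* Let $V$ be a simple vertex superalgebra of countable dimension over $\mathbb{C}$. Then the linear map $$Y(z)\colon V\otimes V\to V((z)),\qquad u\otimes v\mapsto Y(u,z)v\quad (u,v\in V),$$ is injective.
   Context: All vector spaces and tensor products are over $\mathbb{C}$. A vector superspace is a $\mathbb{Z}_2$-graded vector space $V=V_{\bar 0}\oplus V_{\bar 1}$; homogeneous elements $u\in V_{\bar i}$ ($i\in\{0,1\}$) have $|u|=i$. A subsuperspace is a subspace $W$ with $W=(W\cap V_{\bar 0})\oplus (W\cap V_{\bar 1})$. A vertex superalgebra is a triple $(V,Y(\ ,z),\mathbf 1)$ with $V=V_{\bar 0}\oplus V_{\bar 1}$ a vector superspace, $\mathbf 1\in V_{\bar 0}$ (vacuum vector), and a linear map $Y(\ ,z)\colon V\to \mathrm{End}_{\mathbb{C}}(V)[[z,z^{-1}]]$, $v\mapsto Y(v,z)=\sum_{n\in\mathbb{Z}}v_nz^{-n-1}$, such that: (1) for $u,v\in V$, $u_nv=0$ for $n\gg0$; (2) $Y(\mathbf 1,z)=\mathrm{id}_V$ and $Y(v,z)\mathbf 1=v+(v_{-2}\mathbf 1)z+\cdots\in V[[z]]$; (3) $u_nv\in V_{\alpha+\beta}$ for $u\in V_\alpha$, $v\in V_\beta$, $\alpha,\beta\in\mathbb{Z}_2$, $n\in\mathbb{Z}$; (4) for all homogeneous $u,v,w\in V$ the Jacobi identity holds: $$z_0^{-1}\delta\left(\tfrac{z_1-z_2}{z_0}\right)Y(u,z_1)Y(v,z_2)w-(-1)^{|u||v|}z_0^{-1}\delta\left(\tfrac{z_2-z_1}{-z_0}\right)Y(v,z_2)Y(u,z_1)w=z_2^{-1}\delta\left(\tfrac{z_1-z_0}{z_2}\right)Y(Y(u,z_0)v,z_2)w,$$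 where $\delta(z)=\sum_{n\in\mathbb{Z}}z^n$ and binomial powers are expanded in nonnegative powers of the second variable. An ideal of $V$ is a subsuperspace $I\subseteq V$ such that $u_nI\subseteq I$ for all $u\in V$, $n\in\mathbb{Z}$, and $u_nv\in I$ for all $u\in I$, $v\in V$, $n\in\mathbb{Z}$. $V$ is simple if it has no nonzero proper ideals (note that ideals are required to be $\mathbb{Z}_2$-graded subspaces). *)

theory Defs
  imports
    Complex_Main
    "HOL-Library.Poly_Mapping"
    "HOL-Library.Product_Plus"
    "HOL-Library.Z2"
    "HOL-Library.Countable_Set"
    "HOL-Computational_Algebra.Formal_Laurent_Series"
begin

section \<open>Complex vector spaces\<close>

class complex_vector = ab_group_add +
  fixes scaleC :: "complex \<Rightarrow> 'a \<Rightarrow> 'a"  (infixr \<open>*\<^sub>C\<close> 75)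
  assumes scaleC_add_right: "a *\<^sub>C (x + y) = a *\<^sub>C x + a *\<^sub>C y"
    and scaleC_add_left: "(a + b) *\<^sub>C x = a *\<^sub>C x + b *\<^sub>C x"
    and scaleC_scaleC: "a *\<^sub>C b *\<^sub>C x = (a * b) *\<^sub>C x"
    and scaleC_one: "1 *\<^sub>C x = x"

global_interpretation complex_vector:
  vector_space "scaleC :: complex \<Rightarrow> 'a \<Rightarrow> 'a :: complex_vector"
  by unfold_locales (fact scaleC_add_right scaleC_add_left scaleC_scaleC scaleC_one)+

abbreviation clinear :: "('a::complex_vector \<Rightarrow> 'b::complex_vector) \<Rightarrow> bool"
  where "clinear \<equiv> Vector_Spaces.linear scaleC scaleC"

lemma clinear_iff:
  "clinear f \<longleftrightarrow> (\<forall>x y. f (x + y) = f x + f y) \<and> (\<forall>c x. f (c *\<^sub>C x) = c *\<^sub>C f x)"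
  by (simp add: Vector_Spaces.linear_iff complex_vector.vector_space_axioms)

definition cbilinear :: "('a::complex_vector \<Rightarrow> 'b::complex_vector \<Rightarrow> 'c::complex_vector) \<Rightarrow> bool"
  where "cbilinear f \<longleftrightarrow> (\<forall>v. clinear (\<lambda>u. f u v)) \<and> (\<forall>u. clinear (\<lambda>v. f u v))"

definition countable_dimension :: "'a::complex_vector itself \<Rightarrow> bool"
  where "countable_dimension _ \<longleftrightarrow>
    (\<exists>B :: 'a set. countable B \<and> complex_vector.independent B \<and> complex_vector.span B = UNIV)"

definition internal_direct_sum :: "'a::complex_vector set \<Rightarrow> 'a set \<Rightarrow> 'a set \<Rightarrow> bool"
  where "internal_direct_sum W A B \<longleftrightarrow>
    complex_vector.subspace A \<and> complex_vector.subspace B \<and>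
    A \<inter> B = {0} \<and> W = {a + b | a b. a \<in> A \<and> b \<in> B}"

instantiation complex :: complex_vector
begin

definition scaleC_complex :: "complex \<Rightarrow> complex \<Rightarrow> complex"
  where [simp]: "scaleC_complex = (*)"

instance
  by standard (simp_all add: algebra_simps)

end

instantiation poly_mapping :: (type, complex_vector) complex_vector
begin

lift_definition scaleC_poly_mapping :: "complex \<Rightarrow> ('a \<Rightarrow>\<^sub>0 'b) \<Rightarrow> ('a \<Rightarrow>\<^sub>0 'b)"
  is "\<lambda>c f k. c *\<^sub>C f k"
proof -
  fix c and f :: "'a \<Rightarrow> 'b"
  assume "finite {k. f k \<noteq> 0}"
  then show "finite {k. c *\<^sub>C f k \<noteq> 0}"
    by (rule rev_finite_subset) auto
qed

instance
  by standard
    (transfer; simp add: fun_eq_iff scaleC_add_right scaleC_add_left scaleC_scaleC scaleC_one)+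

end

lemma lookup_scaleC [simp]: "Poly_Mapping.lookup (c *\<^sub>C x) k = c *\<^sub>C Poly_Mapping.lookup x k"
  by transfer simp

text \<open>The space \<open>V((z))\<close> of lower-truncated Laurent series with coefficients in \<open>V\<close>.\<close>

instantiation fls :: (complex_vector) complex_vector
begin

lift_definition scaleC_fls :: "complex \<Rightarrow> 'a fls \<Rightarrow> 'a fls"
  is "\<lambda>c f n. c *\<^sub>C f n"
  by (auto elim: eventually_mono)

instance
  by standard
    (transfer; simp add: fun_eq_iff scaleC_add_right scaleC_add_left scaleC_scaleC scaleC_one)+

end

lemma fls_nth_scaleC [simp]: "fls_nth (c *\<^sub>C f) n = c *\<^sub>C fls_nth f n"
  by transfer simp


section \<open>The algebraic tensor product\<close>

text \<open>The quotient of the free vector space on \<open>'a \<times> 'b\<close> by the bilinearity relations.\<close>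

definition tensor_relations :: "(('a::complex_vector \<times> 'b::complex_vector) \<Rightarrow>\<^sub>0 complex) set"
  where "tensor_relations =
    {Poly_Mapping.single (x + y, v) 1 - Poly_Mapping.single (x, v) 1 - Poly_Mapping.single (y, v) 1
      | x y v. True} \<union>
    {Poly_Mapping.single (u, x + y) 1 - Poly_Mapping.single (u, x) 1 - Poly_Mapping.single (u, y) 1
      | u x y. True} \<union>
    {Poly_Mapping.single (c *\<^sub>C u, v) 1 - c *\<^sub>C Poly_Mapping.single (u, v) 1 | c u v. True} \<union>
    {Poly_Mapping.single (u, c *\<^sub>C v) 1 - c *\<^sub>C Poly_Mapping.single (u, v) 1 | c u v. True}"

definition tensor_rel ::
  "(('a::complex_vector \<times> 'b::complex_vector) \<Rightarrow>\<^sub>0 complex) \<Rightarrow> ('a \<times> 'b \<Rightarrow>\<^sub>0 complex) \<Rightarrow> bool"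
  where "tensor_rel x y \<longleftrightarrow> x - y \<in> complex_vector.span tensor_relations"

lemma equivp_tensor_rel:
  "equivp (tensor_rel :: (('a::complex_vector \<times> 'b::complex_vector) \<Rightarrow>\<^sub>0 complex) \<Rightarrow> _)"
proof (rule equivpI)
  let ?R = "tensor_rel :: (('a \<times> 'b) \<Rightarrow>\<^sub>0 complex) \<Rightarrow> _"
  show "reflp ?R"
    by (simp add: reflp_def tensor_rel_def complex_vector.span_zero)
  show "symp ?R"
  proof (rule sympI)
    fix x y :: "('a \<times> 'b) \<Rightarrow>\<^sub>0 complex"
    assume "tensor_rel x y"
    then have "- (x - y) \<in> complex_vector.span tensor_relations"
      unfolding tensor_rel_def by (rule complex_vector.span_neg)
    then show "tensor_rel y x"
      by (simp add: tensor_rel_def)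
  qed
  show "transp ?R"
  proof (rule transpI)
    fix x y z :: "('a \<times> 'b) \<Rightarrow>\<^sub>0 complex"
    assume "tensor_rel x y" "tensor_rel y z"
    then have "(x - y) + (y - z) \<in> complex_vector.span tensor_relations"
      unfolding tensor_rel_def by (rule complex_vector.span_add)
    then show "tensor_rel x z"
      by (simp add: tensor_rel_def)
  qed
qed

quotient_type (overloaded) ('a, 'b) tensor =
  "('a::complex_vector \<times> 'b::complex_vector) \<Rightarrow>\<^sub>0 complex" / tensor_rel
  by (rule equivp_tensor_rel)

instantiation tensor :: (complex_vector, complex_vector) complex_vector
begin

lift_definition zero_tensor :: "('a, 'b) tensor" is 0 .

lift_definition plus_tensor :: "('a, 'b) tensor \<Rightarrow> ('a, 'b) tensor \<Rightarrow> ('a, 'b) tensor" is "(+)"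
proof -
  fix a b c d :: "('a \<times> 'b) \<Rightarrow>\<^sub>0 complex"
  assume "tensor_rel a b" "tensor_rel c d"
  then have "(a - b) + (c - d) \<in> complex_vector.span tensor_relations"
    unfolding tensor_rel_def by (rule complex_vector.span_add)
  then show "tensor_rel (a + c) (b + d)"
    by (simp add: tensor_rel_def add_diff_add)
qed

lift_definition uminus_tensor :: "('a, 'b) tensor \<Rightarrow> ('a, 'b) tensor" is uminus
proof -
  fix a b :: "('a \<times> 'b) \<Rightarrow>\<^sub>0 complex"
  assume "tensor_rel a b"
  then have "- (a - b) \<in> complex_vector.span tensor_relations"
    unfolding tensor_rel_def by (rule complex_vector.span_neg)
  then show "tensor_rel (- a) (- b)"
    by (simp add: tensor_rel_def)
qed

lift_definition minus_tensor :: "('a, 'b) tensor \<Rightarrow> ('a, 'b) tensor \<Rightarrow> ('a, 'b) tensor" is "(-)"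
proof -
  fix a b c d :: "('a \<times> 'b) \<Rightarrow>\<^sub>0 complex"
  assume "tensor_rel a b" "tensor_rel c d"
  then have "(a - b) - (c - d) \<in> complex_vector.span tensor_relations"
    unfolding tensor_rel_def by (rule complex_vector.span_diff)
  then show "tensor_rel (a - c) (b - d)"
    by (simp add: tensor_rel_def diff_diff_eq2 diff_diff_eq add_diff_eq diff_add_eq add.commute)
qed

lift_definition scaleC_tensor :: "complex \<Rightarrow> ('a, 'b) tensor \<Rightarrow> ('a, 'b) tensor" is scaleC
proof -
  fix c and a b :: "('a \<times> 'b) \<Rightarrow>\<^sub>0 complex"
  assume "tensor_rel a b"
  then have "c *\<^sub>C (a - b) \<in> complex_vector.span tensor_relations"
    unfolding tensor_rel_def by (rule complex_vector.span_scale)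
  then show "tensor_rel (c *\<^sub>C a) (c *\<^sub>C b)"
    by (simp only: tensor_rel_def complex_vector.scale_right_diff_distrib)
qed

lemma tensor_rel_refl: "x = y \<Longrightarrow> tensor_rel x y"
  by (simp add: tensor_rel_def complex_vector.span_zero)

instance
  by standard
    (transfer; rule tensor_rel_refl;
      simp add: algebra_simps scaleC_add_right scaleC_add_left scaleC_scaleC scaleC_one)+

end

lift_definition tensor_prod ::
  "'a::complex_vector \<Rightarrow> 'b::complex_vector \<Rightarrow> ('a, 'b) tensor"  (infixl \<open>\<otimes>\<^sub>t\<close> 70)
  is "\<lambda>u v. Poly_Mapping.single (u, v) 1" .

definition free_lift ::
  "('a \<Rightarrow> 'b \<Rightarrow> 'c::complex_vector) \<Rightarrow> (('a \<times> 'b) \<Rightarrow>\<^sub>0 complex) \<Rightarrow> 'c"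
  where "free_lift f x =
    (\<Sum>(u, v) \<in> Poly_Mapping.keys x. Poly_Mapping.lookup x (u, v) *\<^sub>C f u v)"

text \<open>
  The linear map on the tensor product induced by a bilinear map \<open>f\<close>; on non-bilinear \<open>f\<close> the
  value depends on the choice of representatives and is meaningless.
\<close>

definition tensor_lift ::
  "('a \<Rightarrow> 'b \<Rightarrow> 'c) \<Rightarrow> ('a::complex_vector, 'b::complex_vector) tensor \<Rightarrow> 'c::complex_vector"
  where "tensor_lift f t = free_lift f (rep_tensor t)"

lemma free_lift_superset:
  assumes "finite S" "Poly_Mapping.keys x \<subseteq> S"
  shows "free_lift f x = (\<Sum>(u, v) \<in> S. Poly_Mapping.lookup x (u, v) *\<^sub>C f u v)"
  unfolding free_lift_def
  using assms by (intro sum.mono_neutral_left) (auto simp: in_keys_iff)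

lemma free_lift_add: "free_lift f (x + y) = free_lift f x + free_lift f y"
proof -
  let ?S = "Poly_Mapping.keys x \<union> Poly_Mapping.keys y"
  have "Poly_Mapping.keys (x + y) \<subseteq> ?S"
    by (rule Poly_Mapping.keys_add)
  then show ?thesis
    by (simp add: free_lift_superset[of ?S] lookup_add scaleC_add_left
        case_prod_unfold sum.distrib)
qed

lemma free_lift_scaleC: "free_lift f (c *\<^sub>C x) = c *\<^sub>C free_lift f x"
proof -
  have "Poly_Mapping.keys (c *\<^sub>C x) \<subseteq> Poly_Mapping.keys x"
    by (auto simp: in_keys_iff)
  then show ?thesis
    by (simp add: free_lift_superset[of "Poly_Mapping.keys x"] scaleC_scaleC
        case_prod_unfold complex_vector.scale_sum_right)
qed

lemma free_lift_diff: "free_lift f (x - y) = free_lift f x - free_lift f y"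
  using free_lift_add[of f "x - y" y] by simp

lemma free_lift_single: "free_lift f (Poly_Mapping.single (u, v) c) = c *\<^sub>C f u v"
  by (simp add: free_lift_superset[of "{(u, v)}"])

lemma free_lift_respects:
  assumes "cbilinear f" "tensor_rel x y"
  shows "free_lift f x = free_lift f y"
proof -
  have bil: "f (a + b) v = f a v + f b v" "f u (c + d) = f u c + f u d"
    "f (k *\<^sub>C a) v = k *\<^sub>C f a v" "f u (k *\<^sub>C c) = k *\<^sub>C f u c" for a b c d u v k
    using assms(1) by (auto simp: cbilinear_def clinear_iff)
  have "z \<in> complex_vector.span tensor_relations \<Longrightarrow> free_lift f z = 0" for z
  proof (induction rule: complex_vector.span_induct_alt)
    case base
    show ?case by (simp add: free_lift_def)
  next
    case (step c x y)
    then show ?case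
      by (auto simp: tensor_relations_def free_lift_add free_lift_scaleC free_lift_diff
          free_lift_single bil scaleC_one)
  qed
  then show ?thesis
    using assms(2) free_lift_diff[of f x y] by (simp add: tensor_rel_def)
qed

lemma tensor_lift_abs:
  assumes "cbilinear f"
  shows "tensor_lift f (abs_tensor x) = free_lift f x"
  unfolding tensor_lift_def
  by (rule free_lift_respects[OF assms])
    (metis Quotient3_tensor rep_abs_rsp_left equivp_reflp equivp_tensor_rel)

lemma tensor_lift_prod: "cbilinear f \<Longrightarrow> tensor_lift f (u \<otimes>\<^sub>t v) = f u v"
  by (simp add: tensor_prod.abs_eq tensor_lift_abs free_lift_single scaleC_one)

lemma clinear_tensor_lift:
  assumes "cbilinear f"
  shows "clinear (tensor_lift f)"
  unfolding clinear_iff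
proof (intro conjI allI)
  fix s t :: "('a, 'b) tensor" and c
  obtain x y where [simp]: "s = abs_tensor x" "t = abs_tensor y"
    by (metis Quotient3_abs_rep[OF Quotient3_tensor])
  show "tensor_lift f (s + t) = tensor_lift f s + tensor_lift f t"
    by (simp add: plus_tensor.abs_eq tensor_lift_abs[OF assms] free_lift_add)
  show "tensor_lift f (c *\<^sub>C s) = c *\<^sub>C tensor_lift f s"
    by (simp add: scaleC_tensor.abs_eq tensor_lift_abs[OF assms] free_lift_scaleC)
qed


section \<open>Formal calculus in three variables\<close>

text \<open>
  An element of \<open>A[[z\<^sub>0\<^sup>\<plusminus>\<^sup>1, z\<^sub>1\<^sup>\<plusminus>\<^sup>1, z\<^sub>2\<^sup>\<plusminus>\<^sup>1]]\<close> is the function sending \<open>(a, b, c)\<close> to its coefficient at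
  \<open>z\<^sub>0\<^sup>a z\<^sub>1\<^sup>b z\<^sub>2\<^sup>c\<close>.
\<close>

type_synonym 'a fseries3 = "int \<times> int \<times> int \<Rightarrow> 'a"

text \<open>
  Product of a scalar series with a vector-valued one. It is used only where every coefficient is a
  finite sum (see \<open>vertex_superalgebra.jacobi_products_exist\<close> below); \<open>Sum_any\<close> returns
  \<open>0\<close> on infinite supports.
\<close>

definition fseries3_times :: "complex fseries3 \<Rightarrow> 'a::complex_vector fseries3 \<Rightarrow> 'a fseries3"
  where "fseries3_times f g = (\<lambda>e. Sum_any (\<lambda>d. f d *\<^sub>C g (e - d)))"

text \<open>The coefficient at \<open>y\<^sup>b w\<^sup>c\<close> of \<open>(y - w)\<^sup>n\<close>, expanded in nonnegative powers of \<open>w\<close>.\<close>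

definition binomial_coeff :: "int \<Rightarrow> int \<Rightarrow> int \<Rightarrow> complex"
  where "binomial_coeff n b c =
    (if 0 \<le> c \<and> b + c = n then (-1) ^ nat c * (of_int n gchoose nat c) else 0)"

text \<open>
  The coefficient at \<open>x\<^sup>a y\<^sup>b w\<^sup>c\<close> of
  \<open>x\<^sup>-\<^sup>1 \<delta>((y - w) / (s x)) = (\<Sum>n\<in>\<int>. s\<^sup>-\<^sup>n x\<^sup>-\<^sup>n\<^sup>-\<^sup>1 (y - w)\<^sup>n)\<close>, where \<open>s = \<plusminus>1\<close>.
\<close>

definition delta_coeff :: "complex \<Rightarrow> int \<Rightarrow> int \<Rightarrow> int \<Rightarrow> complex"
  where "delta_coeff s a b c = s powi (a + 1) * binomial_coeff (- a - 1) b c"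

text \<open>
  \<open>z\<^sub>0\<^sup>-\<^sup>1 \<delta>((z\<^sub>1 - z\<^sub>2) / z\<^sub>0)\<close>, \<open>z\<^sub>0\<^sup>-\<^sup>1 \<delta>((z\<^sub>2 - z\<^sub>1) / (- z\<^sub>0))\<close> and \<open>z\<^sub>2\<^sup>-\<^sup>1 \<delta>((z\<^sub>1 - z\<^sub>0) / z\<^sub>2)\<close>.
\<close>

definition delta_12_0 :: "complex fseries3"
  where "delta_12_0 = (\<lambda>(a, b, c). delta_coeff 1 a b c)"

definition delta_21_0 :: "complex fseries3"
  where "delta_21_0 = (\<lambda>(a, b, c). delta_coeff (-1) a c b)"

definition delta_10_2 :: "complex fseries3"
  where "delta_10_2 = (\<lambda>(a, b, c). delta_coeff 1 c b a)"


section \<open>Vertex superalgebras\<close>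

text \<open>In this section \<open>Y u n v\<close> is \<open>u\<^sub>n v\<close>, the coefficient of \<open>z\<^sup>-\<^sup>n\<^sup>-\<^sup>1\<close> in \<open>Y(u, z) v\<close>.\<close>

definition Y_Y_series1 :: "('v \<Rightarrow> int \<Rightarrow> 'v \<Rightarrow> 'v::complex_vector) \<Rightarrow> 'v \<Rightarrow> 'v \<Rightarrow> 'v \<Rightarrow> 'v fseries3"
  where "Y_Y_series1 Y u v w =
    (\<lambda>(a, b, c). if a = 0 then Y u (- b - 1) (Y v (- c - 1) w) else 0)"
  \<comment> \<open>\<open>Y(u, z\<^sub>1) Y(v, z\<^sub>2) w\<close>\<close>

definition Y_Y_series2 :: "('v \<Rightarrow> int \<Rightarrow> 'v \<Rightarrow> 'v::complex_vector) \<Rightarrow> 'v \<Rightarrow> 'v \<Rightarrow> 'v \<Rightarrow> 'v fseries3"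
  where "Y_Y_series2 Y u v w =
    (\<lambda>(a, b, c). if a = 0 then Y v (- c - 1) (Y u (- b - 1) w) else 0)"
  \<comment> \<open>\<open>Y(v, z\<^sub>2) Y(u, z\<^sub>1) w\<close>\<close>

definition Y_iterate_series ::
  "('v \<Rightarrow> int \<Rightarrow> 'v \<Rightarrow> 'v::complex_vector) \<Rightarrow> 'v \<Rightarrow> 'v \<Rightarrow> 'v \<Rightarrow> 'v fseries3"
  where "Y_iterate_series Y u v w =
    (\<lambda>(a, b, c). if b = 0 then Y (Y u (- a - 1) v) (- c - 1) w else 0)"
  \<comment> \<open>\<open>Y(Y(u, z\<^sub>0) v, z\<^sub>2) w\<close>\<close>

definition super_sign :: "bit \<Rightarrow> bit \<Rightarrow> complex"
  where "super_sign \<alpha> \<beta> = (if \<alpha> = 1 \<and> \<beta> = 1 then - 1 else 1)"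

lemma Sum_any_reindex_range:
  assumes "inj h" "\<And>d. g d \<noteq> 0 \<Longrightarrow> d \<in> range h"
  shows "Sum_any g = Sum_any (\<lambda>i. g (h i))"
proof -
  have "{d. g d \<noteq> 0} = h ` {i. g (h i) \<noteq> 0}"
    using assms(2) by auto
  then show ?thesis
    using assms(1) by (simp add: Sum_any.expand_set sum.reindex inj_on_def)
qed

lemma coeff_delta_12_0: "fseries3_times delta_12_0 (Y_Y_series1 Y u v w) (- l - 1, - m - 1, - n - 1) =
  Sum_any (\<lambda>i::nat. ((-1) ^ i * (of_int l gchoose i)) *\<^sub>C Y u (l + m - int i) (Y v (n + int i) w))"
  unfolding fseries3_times_def
  apply (subst Sum_any_reindex_range[where h = "\<lambda>i::nat. (- l - 1, l - int i, int i)"])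
  apply (simp add: inj_on_def)
  subgoal for d
    apply (cases d)
    apply (auto simp: delta_12_0_def Y_Y_series1_def delta_coeff_def binomial_coeff_def image_iff split: if_splits)
    by (metis add_diff_cancel_right' nonneg_int_cases)
  apply (rule Sum_any.cong)
  apply (simp add: delta_12_0_def Y_Y_series1_def delta_coeff_def binomial_coeff_def algebra_simps)
  done

lemma coeff_delta_21_0: "fseries3_times delta_21_0 (Y_Y_series2 Y u v w) (- l - 1, - m - 1, - n - 1) =
  Sum_any (\<lambda>i::nat. ((-1) powi l * (-1) ^ i * (of_int l gchoose i)) *\<^sub>C Y v (l + n - int i) (Y u (m + int i) w))"
  unfolding fseries3_times_def
  apply (subst Sum_any_reindex_range[where h = "\<lambda>i::nat. (- l - 1, int i, l - int i)"])
  apply (simp add: inj_on_def)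
  subgoal for d
    apply (cases d)
    apply (auto simp: delta_21_0_def Y_Y_series2_def delta_coeff_def binomial_coeff_def image_iff split: if_splits)
    by (metis add_diff_cancel_right' nonneg_int_cases)
  apply (rule Sum_any.cong)
  apply (simp add: delta_21_0_def Y_Y_series2_def delta_coeff_def binomial_coeff_def algebra_simps power_int_minus_left)
  done

lemma coeff_delta_10_2: "fseries3_times delta_10_2 (Y_iterate_series Y u v w) (- l - 1, - m - 1, - n - 1) =
  Sum_any (\<lambda>i::nat. (of_int m gchoose i) *\<^sub>C Y (Y u (l + int i) v) (m + n - int i) w)"
  unfolding fseries3_times_def
  apply (subst Sum_any_reindex_range[where h = "\<lambda>i::nat. (int i, - m - 1, m - int i)"])
  apply (simp add: inj_on_def)
  subgoal for d
    apply (cases d)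
    apply (auto simp: delta_10_2_def Y_iterate_series_def delta_coeff_def binomial_coeff_def image_iff split: if_splits)
    by (metis add_diff_cancel_right' nonneg_int_cases add.commute diff_diff_eq2 minus_diff_eq diff_minus_eq_add)
  apply (rule Sum_any.cong)
  subgoal for i
  apply (simp add: delta_10_2_def Y_iterate_series_def delta_coeff_def binomial_coeff_def algebra_simps)
  using gbinomial_negated_upper[of "of_int m :: complex" i]
  apply (simp add: algebra_simps)
  done
  done


text \<open>
  The superspace is the whole type, with even and odd parts \<open>V 0\<close> and \<open>V 1\<close>. The Jacobi identity
  is an identity of formal series, stated at each exponent triple \<open>e\<close>.
\<close>

locale vertex_superalgebra =
  fixes V :: "bit \<Rightarrow> 'v::complex_vector set"
    and Y :: "'v \<Rightarrow> int \<Rightarrow> 'v \<Rightarrow> 'v"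
    and vac :: 'v
  assumes grading: "internal_direct_sum UNIV (V 0) (V 1)"
    and vac_even: "vac \<in> V 0"
    and Y_linear_left: "clinear (\<lambda>u. Y u n v)"
    and Y_linear_right: "clinear (Y u n)"
    and truncation: "\<exists>N. \<forall>n\<ge>N. Y u n v = 0"
    and vacuum: "Y vac n v = (if n = - 1 then v else 0)"
    and creation_regular: "n \<ge> 0 \<Longrightarrow> Y v n vac = 0"
    and creation: "Y v (- 1) vac = v"
    and Y_graded: "u \<in> V \<alpha> \<Longrightarrow> v \<in> V \<beta> \<Longrightarrow> Y u n v \<in> V (\<alpha> + \<beta>)"
    and jacobi: "u \<in> V \<alpha> \<Longrightarrow> v \<in> V \<beta> \<Longrightarrow> w \<in> V \<gamma> \<Longrightarrow>
      fseries3_times delta_12_0 (Y_Y_series1 Y u v w) e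
        - super_sign \<alpha> \<beta> *\<^sub>C fseries3_times delta_21_0 (Y_Y_series2 Y u v w) e
      = fseries3_times delta_10_2 (Y_iterate_series Y u v w) e"

context vertex_superalgebra
begin

lemma Y_add_left: "Y (u + u') n v = Y u n v + Y u' n v"
  and Y_scaleC_left: "Y (c *\<^sub>C u) n v = c *\<^sub>C Y u n v"
  and Y_add_right: "Y u n (v + v') = Y u n v + Y u n v'"
  and Y_scaleC_right: "Y u n (c *\<^sub>C v) = c *\<^sub>C Y u n v"
  using Y_linear_left[of n v] Y_linear_right[of u n] by (simp_all add: clinear_iff)

lemma Y_zero_left: "Y 0 n v = 0" and Y_zero_right: "Y u n 0 = 0"
  using Y_scaleC_left[of 0 0 n v] Y_scaleC_right[of u n 0 0] by simp_all

lemma jacobi_products_exist: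
  "finite {d. delta_12_0 d *\<^sub>C Y_Y_series1 Y u v w (e - d) \<noteq> 0}" (is ?A)
  "finite {d. delta_21_0 d *\<^sub>C Y_Y_series2 Y u v w (e - d) \<noteq> 0}" (is ?B)
  "finite {d. delta_10_2 d *\<^sub>C Y_iterate_series Y u v w (e - d) \<noteq> 0}" (is ?C)
proof -
  obtain a b c where e: "e = (a, b, c)"
    by (cases e)
  obtain N where N: "\<And>n. n \<ge> N \<Longrightarrow> Y v n w = 0"
    using truncation by blast
  have "{d. delta_12_0 d *\<^sub>C Y_Y_series1 Y u v w (e - d) \<noteq> 0} \<subseteq>
      (\<lambda>i. (a, - a - 1 - i, i)) ` {0..N + c + 1}"
    using N by (auto simp: e delta_12_0_def Y_Y_series1_def delta_coeff_def binomial_coeff_def image_iff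
        Y_zero_right not_le[symmetric] split: if_splits) (force simp: Y_zero_right intro: ccontr)+
  then show ?A
    by (rule finite_subset) simp
  obtain N where N: "\<And>n. n \<ge> N \<Longrightarrow> Y u n w = 0"
    using truncation by blast
  have "{d. delta_21_0 d *\<^sub>C Y_Y_series2 Y u v w (e - d) \<noteq> 0} \<subseteq>
      (\<lambda>i. (a, i, - a - 1 - i)) ` {0..N + b + 1}"
    using N by (auto simp: e delta_21_0_def Y_Y_series2_def delta_coeff_def binomial_coeff_def image_iff
        Y_zero_right split: if_splits) (force simp: Y_zero_right intro: ccontr)+
  then show ?B
    by (rule finite_subset) simp
  obtain N where N: "\<And>n. n \<ge> N \<Longrightarrow> Y u n v = 0"
    using truncation by blast
  have "{d. delta_10_2 d *\<^sub>C Y_iterate_series Y u v w (e - d) \<noteq> 0} \<subseteq>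
      (\<lambda>i. (i, b, - b - 1 - i)) ` {0..N + a + 1}"
    using N by (auto simp: e delta_10_2_def Y_iterate_series_def delta_coeff_def binomial_coeff_def image_iff
        Y_zero_left split: if_splits) (force simp: Y_zero_left intro: ccontr)+
  then show ?C
    by (rule finite_subset) simp
qed

lemma borcherds_identity:
  assumes "u \<in> V \<alpha>" "v \<in> V \<beta>" "w \<in> V \<gamma>"
  shows "Sum_any (\<lambda>i::nat. ((-1) ^ i * (of_int l gchoose i)) *\<^sub>C Y u (l + m - int i) (Y v (n + int i) w))
     - super_sign \<alpha> \<beta> *\<^sub>C Sum_any (\<lambda>i::nat.
         ((-1) powi l * (-1) ^ i * (of_int l gchoose i)) *\<^sub>C Y v (l + n - int i) (Y u (m + int i) w))
     = Sum_any (\<lambda>i::nat. (of_int m gchoose i) *\<^sub>C Y (Y u (l + int i) v) (m + n - int i) w)"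
  using jacobi[OF assms, of "(- l - 1, - m - 1, - n - 1)"] by (simp only: coeff_delta_12_0 coeff_delta_21_0 coeff_delta_10_2)

definition subsuperspace :: "'v set \<Rightarrow> bool"
  where "subsuperspace W \<longleftrightarrow>
    complex_vector.subspace W \<and> internal_direct_sum W (W \<inter> V 0) (W \<inter> V 1)"

definition ideal :: "'v set \<Rightarrow> bool"
  where "ideal I \<longleftrightarrow> subsuperspace I \<and>
    (\<forall>u n. \<forall>x\<in>I. Y u n x \<in> I) \<and> (\<forall>u\<in>I. \<forall>v n. Y u n v \<in> I)"

end

locale simple_vertex_superalgebra = vertex_superalgebra +
  assumes simple: "ideal I \<Longrightarrow> I = {0} \<or> I = UNIV"

text \<open>\<open>Y(u, z) v\<close> as an element of \<open>V((z))\<close>, and the map \<open>Y(z)\<close> on \<open>V \<otimes> V\<close>.\<close>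

definition Y_laurent :: "('v \<Rightarrow> int \<Rightarrow> 'v \<Rightarrow> 'v::complex_vector) \<Rightarrow> 'v \<Rightarrow> 'v \<Rightarrow> 'v fls"
  where "Y_laurent Y u v = Abs_fls (\<lambda>k. Y u (- k - 1) v)"

definition Y_tensor ::
  "('v \<Rightarrow> int \<Rightarrow> 'v \<Rightarrow> 'v::complex_vector) \<Rightarrow> ('v, 'v) tensor \<Rightarrow> 'v fls"
  where "Y_tensor Y = tensor_lift (Y_laurent Y)"

context vertex_superalgebra
begin

lemma nth_Y_laurent: "fls_nth (Y_laurent Y u v) k = Y u (- k - 1) v"
proof -
  obtain N where "\<forall>n\<ge>N. Y u n v = 0"
    using truncation by blast
  then have "\<forall>k < - N. Y u (- k - 1) v = 0"
    by simp
  then show ?thesis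
    unfolding Y_laurent_def by (rule nth_Abs_fls_lower_bound)
qed

lemma cbilinear_Y_laurent: "cbilinear (Y_laurent Y)"
  unfolding cbilinear_def clinear_iff
  by (intro conjI allI fls_eqI)
    (simp_all add: nth_Y_laurent Y_add_left Y_scaleC_left Y_add_right Y_scaleC_right)

lemma clinear_Y_tensor: "clinear (Y_tensor Y)"
  unfolding Y_tensor_def by (rule clinear_tensor_lift[OF cbilinear_Y_laurent])

lemma Y_tensor_prod: "Y_tensor Y (u \<otimes>\<^sub>t v) = Y_laurent Y u v"
  unfolding Y_tensor_def by (rule tensor_lift_prod[OF cbilinear_Y_laurent])

end

end

theory Submission
  imports
    Defs
    "HOL-Computational_Algebra.Fundamental_Theorem_Algebra"
    "HOL-Analysis.Continuum_Not_Denumerable"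
begin

text \<open>
  Locality says that \<open>(z\<^sub>1 - z\<^sub>2)\<^sup>k\<close> kills the supercommutator of \<open>Y(a, z\<^sub>1)\<close> and \<open>Y(u, z\<^sub>2)\<close>, and
  \<open>(z\<^sub>1 - z\<^sub>2)\<^sup>k\<close> is invertible on lower-truncated series in \<open>z\<^sub>1\<close>; so, up to a sign twist, the kernel of
  \<open>Y(z)\<close> is stable under every \<open>1 \<otimes> a\<^sub>n\<close>, and likewise under \<open>1 \<otimes> D\<close> with \<open>D\<close> the translation
  operator. Simplicity of \<open>V\<close> means that the modes and \<open>D\<close> act irreducibly, and in countable
  dimension their commutant is \<open>\<complex>\<close> by Schur's lemma in the form of Dixmier. By density a nonzero kernel
  would therefore contain some \<open>u \<otimes> V\<close> with \<open>u \<noteq> 0\<close>, which is impossible since \<open>u\<^sub>-\<^sub>1 vac = u\<close>.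
\<close>

section \<open>Operators without eigenvalues\<close>

lemma
  assumes "clinear f"
  shows clinear_add: "f (x + y) = f x + f y"
    and clinear_scale: "f (c *\<^sub>C x) = c *\<^sub>C f x"
    and clinear_zero: "f 0 = 0"
    and clinear_diff: "f (x - y) = f x - f y"
    and clinear_sum: "f (sum h S) = (\<Sum>i\<in>S. f (h i))"
proof -
  show add: "f (x + y) = f x + f y" for x y
    using assms by (simp add: clinear_iff)
  show "f (c *\<^sub>C x) = c *\<^sub>C f x"
    using assms by (simp add: clinear_iff)
  show zero: "f 0 = 0"
    using add[of 0 0] by simp
  show "f (x - y) = f x - f y"
    using add[of "x - y" y] by simp
  show "f (sum h S) = (\<Sum>i\<in>S. f (h i))"
    by (induction S rule: infinite_finite_induct) (simp_all add: zero add)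
qed

text \<open>Extend to a basis; any two bases are in bijection.\<close>

lemma countable_independent:
  assumes "countable_dimension TYPE('a::complex_vector)"
    and A: "complex_vector.independent (A :: 'a set)"
  shows "countable A"
proof -
  obtain B :: "'a set" where B: "countable B" "complex_vector.independent B"
      "complex_vector.span B = UNIV"
    using assms(1) unfolding countable_dimension_def by (elim exE conjE)
  obtain A' where A': "A \<subseteq> A'" "complex_vector.independent A'" "UNIV \<subseteq> complex_vector.span A'"
    by (rule complex_vector.maximal_independent_subset_extend[OF subset_UNIV A])
  have "complex_vector.span A' = complex_vector.span B"
    unfolding B(3) by (rule antisym[OF subset_UNIV A'(3)])
  from complex_vector.bij_if_span_eq_span_bases[OF A'(2) B(2) this]
  obtain h where "bij_betw h A' B"
    by (rule exE)
  then have "inj_on h A'" "h ` A' = B"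
    by (simp_all add: bij_betw_def)
  with B(1) have "countable A'"
    using countable_image_inj_on[of h A'] by simp
  with A'(1) show ?thesis
    by (rule countable_subset)
qed

section \<open>Polynomials in a linear operator, evaluated by Horner's scheme\<close>

definition poly_op :: "('a::complex_vector \<Rightarrow> 'a) \<Rightarrow> complex poly \<Rightarrow> 'a \<Rightarrow> 'a"
  where "poly_op g p = fold_coeffs (\<lambda>a h x. a *\<^sub>C x + g (h x)) p (\<lambda>_. 0)"

context
  fixes g :: "'a::complex_vector \<Rightarrow> 'a"
  assumes g: "clinear g"
begin

lemma poly_op_0 [simp]: "poly_op g 0 x = 0"
  by (simp add: poly_op_def)

lemma poly_op_pCons [simp]: "poly_op g (pCons a p) x = a *\<^sub>C x + g (poly_op g p x)"
  \<comment> \<open>\<open>pCons 0 0\<close> collapses to \<open>0\<close>, so this case has to be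
    checked apart, through \<open>g 0 = 0\<close>.\<close>
  by (cases "p = 0 \<and> a = 0") (auto simp: poly_op_def clinear_zero[OF g])

lemma clinear_poly_op: "clinear (poly_op g p)"
  unfolding clinear_iff
proof (intro conjI allI)
  show "poly_op g p (x + y) = poly_op g p x + poly_op g p y" for x y
    by (induction p) (simp_all add: scaleC_add_right clinear_add[OF g])
  show "poly_op g p (c *\<^sub>C x) = c *\<^sub>C poly_op g p x" for c x
    by (induction p) (simp_all add: scaleC_add_right clinear_scale[OF g] scaleC_scaleC mult.commute)
qed

lemma poly_op_add: "poly_op g (p + q) x = poly_op g p x + poly_op g q x"
  by (induction p q rule: poly_induct2) (simp_all add: scaleC_add_left clinear_add[OF g])

lemma poly_op_smult: "poly_op g (smult c p) x = c *\<^sub>C poly_op g p x"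
  by (induction p) (simp_all add: scaleC_add_right scaleC_scaleC clinear_scale[OF g])

lemma poly_op_sum: "poly_op g (sum p S) x = (\<Sum>i\<in>S. poly_op g (p i) x)"
  by (induction S rule: infinite_finite_induct) (simp_all add: poly_op_add)

lemma poly_op_mult: "poly_op g (p * q) x = poly_op g p (poly_op g q x)"
  by (induction p) (simp_all add: poly_op_add poly_op_smult)

lemma poly_op_linear: "poly_op g [:- c, 1:] x = g x - c *\<^sub>C x"
  by (simp add: scaleC_one clinear_zero[OF g])

text \<open>Over the complex numbers \<open>p\<close> splits into linear factors, and each
  \<open>g - c\<close> is injective because \<open>g\<close> has no eigenvalue.\<close>

lemma poly_op_injective:
  assumes inj: "\<And>c x. g x = c *\<^sub>C x \<Longrightarrow> x = 0"
    and "p \<noteq> 0" "poly_op g p x = 0"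
  shows "x = 0"
  using assms(2,3)
proof (induction "degree p" arbitrary: p)
  case 0
  then obtain a where "p = [:a:]"
    using degree_eq_zeroE by metis
  with 0 show ?case
    by (auto simp: clinear_zero[OF g])
next
  case (Suc n)
  then have "\<not> constant (poly p)"
    by (simp add: constant_degree)
  then obtain c where "poly p c = 0"
    using fundamental_theorem_of_algebra by blast
  then obtain q where q: "p = [:- c, 1:] * q"
    by (auto simp: poly_eq_0_iff_dvd elim: dvdE)
  have "q \<noteq> 0"
    using q Suc.prems by auto
  then have "n = degree q"
    using Suc.hyps(2) by (simp add: q degree_mult_eq del: mult_pCons_left)
  moreover have "poly_op g q x = 0"
    using Suc.prems(2) inj unfolding q poly_op_mult poly_op_linear by simp
  ultimately show ?case
    using Suc.hyps(1) \<open>q \<noteq> 0\<close> by blast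
qed

text \<open>
  If \<open>g\<close> has no eigenvalue and all \<open>g - c\<close> are onto, the space is a vector space over the
  rational function field, so the vectors \<open>(g - c)\<^sup>-\<^sup>1 v\<close> are independent.
\<close>

lemma eigenvalue_or_not_surjective:
  fixes v :: 'a
  assumes dim: "countable_dimension TYPE('a)" and v: "v \<noteq> 0"
    and inj: "\<And>c x. g x = c *\<^sub>C x \<Longrightarrow> x = 0"
    and surj: "\<And>c y. \<exists>x. g x - c *\<^sub>C x = y"
  shows False
proof -
  obtain X where X: "\<And>c. g (X c) - c *\<^sub>C X c = v"
    using choice[of "\<lambda>c x. g x - c *\<^sub>C x = v"] surj by auto
  \<comment> \<open>Distinct scalars give distinct vectors, so relations in \<open>range X\<close>
    may be indexed by scalars and \<open>range X\<close> is uncountable.\<close>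
  have inj_X: "inj X"
  proof (rule injI)
    fix c d assume eq: "X c = X d"
    have "g (X c) - c *\<^sub>C X c = g (X c) - d *\<^sub>C X c"
      using X[of c] X[of d] by (simp only: eq)
    then have "c = d \<or> X c = 0"
      by simp
    moreover have "X c \<noteq> 0"
      using X[of c] v by (auto simp: clinear_zero[OF g])
    ultimately show "c = d"
      by blast
  qed
  have "complex_vector.independent (range X)"
    unfolding complex_vector.independent_explicit_finite_subsets
  proof (intro allI impI ballI)
    fix S u y
    assume S: "S \<subseteq> range X" "finite S" and sum0: "(\<Sum>y\<in>S. u y *\<^sub>C y) = 0" and y: "y \<in> S"
    obtain C where C: "finite C" "S = X ` C"
      using S by (metis finite_subset_image)
    obtain c0 where c0: "c0 \<in> C" "y = X c0"
      using y C by blast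
    \<comment> \<open>\<open>P C\<close> is a common denominator: with \<open>P C\<close> applied to
      \<open>w\<close> equal to \<open>v\<close>, each \<open>X c\<close> is a polynomial in
      \<open>g\<close> applied to \<open>w\<close>, and a linear relation becomes a single
      polynomial \<open>q\<close> with \<open>q(g) w = 0\<close>.\<close>
    define P where "P A = (\<Prod>d\<in>A. [:- d, 1:])" for A :: "complex set"
    have "\<exists>w. poly_op g (P C) w = v"
      using C(1)
    proof (induction rule: finite_induct)
      case empty
      show ?case
        by (auto simp: P_def one_pCons scaleC_one clinear_zero[OF g])
    next
      case (insert d C)
      obtain w where w: "poly_op g (P C) w = v"
        using insert.IH by (rule exE)
      obtain w' where w': "g w' - d *\<^sub>C w' = w"
        using surj[of d w] by (rule exE)
      have "P (insert d C) = P C * [:- d, 1:]"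
        using insert.hyps by (simp add: P_def mult.commute del: mult_pCons_left mult_pCons_right)
      then have "poly_op g (P (insert d C)) w' = v"
        using w w' by (simp only: poly_op_mult poly_op_linear)
      then show ?case
        by (rule exI)
    qed
    then obtain w where w: "poly_op g (P C) w = v"
      by blast
    have w0: "w \<noteq> 0"
      using w v clinear_zero[OF clinear_poly_op] by auto
    have Xw: "X c = poly_op g (P (C - {c})) w" if "c \<in> C" for c
    proof -
      have "P C = [:- c, 1:] * P (C - {c})"
        using that C(1) by (simp add: P_def prod.remove del: mult_pCons_left)
      then have "g (poly_op g (P (C - {c})) w) - c *\<^sub>C poly_op g (P (C - {c})) w = v"
        using w by (simp only: poly_op_mult poly_op_linear)
      then have "g (X c - poly_op g (P (C - {c})) w) = c *\<^sub>C (X c - poly_op g (P (C - {c})) w)"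
        using X[of c] by (simp add: clinear_diff[OF g] complex_vector.scale_right_diff_distrib algebra_simps)
      then show ?thesis
        using inj by fastforce
    qed
    define q where "q = (\<Sum>c\<in>C. smult (u (X c)) (P (C - {c})))"
    have "poly_op g q w = (\<Sum>c\<in>C. u (X c) *\<^sub>C X c)"
      by (simp add: q_def poly_op_sum poly_op_smult Xw)
    also have "\<dots> = 0"
      using sum0 inj_X by (simp add: C(2) sum.reindex inj_on_def)
    finally have qw: "poly_op g q w = 0" .
    have "q = 0"
    proof (rule ccontr)
      assume "q \<noteq> 0"
      from inj this qw have "w = 0"
        by (rule poly_op_injective)
      with w0 show False ..
    qed
    \<comment> \<open>Lagrange interpolation: at \<open>c0\<close> every summand with
      \<open>c \<noteq> c0\<close> contains the factor \<open>c0 - c0\<close>.\<close>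
    then have "0 = poly q c0"
      by simp
    also have "\<dots> = (\<Sum>c\<in>C. u (X c) * (\<Prod>d\<in>C - {c}. c0 - d))"
      by (simp add: q_def P_def poly_sum poly_prod)
    also have "\<dots> = (\<Sum>c\<in>{c0}. u (X c) * (\<Prod>d\<in>C - {c}. c0 - d))"
      using C(1) c0(1) by (intro sum.mono_neutral_right) (auto intro!: prod_zero)
    finally show "u y = 0"
      using C(1) c0(2) by auto
  qed
  then have "countable (range X)"
    by (rule countable_independent[OF dim])
  then have "countable (UNIV :: complex set)"
    using inj_X countable_image_inj_on by blast
  then show False
    using uncountable_UNIV_complex by blast
qed

end

section \<open>Irreducible actions in countable dimension\<close>

text \<open>\<open>F\<close> is a bare set of generators rather than an algebra, and the zero space
  counts as irreducible.\<close>

definition irreducible_action :: "('a::complex_vector \<Rightarrow> 'a) set \<Rightarrow> bool"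
  where "irreducible_action F \<longleftrightarrow>
    (\<forall>f\<in>F. clinear f) \<and>
    (\<forall>W. complex_vector.subspace W \<longrightarrow> (\<forall>f\<in>F. \<forall>x\<in>W. f x \<in> W) \<longrightarrow> W = {0} \<or> W = UNIV)"

lemma irreducible_action_clinear: "irreducible_action F \<Longrightarrow> f \<in> F \<Longrightarrow> clinear f"
  by (simp add: irreducible_action_def)

lemma irreducible_action_subspace:
  assumes "irreducible_action F" "complex_vector.subspace W" "\<And>f x. f \<in> F \<Longrightarrow> x \<in> W \<Longrightarrow> f x \<in> W"
  shows "W = {0} \<or> W = UNIV"
  using assms by (simp add: irreducible_action_def)

text \<open>Kernel and range of \<open>g - c\<close> are stable under \<open>F\<close>. If
  \<open>g\<close> is not a scalar, irreducibility makes every \<open>g - c\<close> bijective, which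
  countable dimension excludes.\<close>

lemma schur:
  fixes g :: "'a::complex_vector \<Rightarrow> 'a"
  assumes dim: "countable_dimension TYPE('a)" and F: "irreducible_action F"
    and g: "clinear g" and comm: "\<And>f x. f \<in> F \<Longrightarrow> g (f x) = f (g x)"
  shows "\<exists>c. \<forall>x. g x = c *\<^sub>C x"
proof (rule ccontr)
  assume False: "\<not> ?thesis"
  note Fl = irreducible_action_clinear[OF F]
  have inj: "x = 0" if "g x = c *\<^sub>C x" for c x
  proof -
    have "{x. g x = c *\<^sub>C x} = {0} \<or> {x. g x = c *\<^sub>C x} = UNIV"
      by (rule irreducible_action_subspace[OF F])
        (auto simp: complex_vector.subspace_def clinear_zero[OF g] clinear_add[OF g]
          clinear_scale[OF g] scaleC_add_right scaleC_scaleC mult.commute comm clinear_scale[OF Fl])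
    with False that show ?thesis
      by blast
  qed
  have surj: "\<exists>x. g x - c *\<^sub>C x = y" for c y
  proof -
    let ?h = "\<lambda>x. g x - c *\<^sub>C x"
    have h: "clinear ?h"
      by (simp add: clinear_iff clinear_add[OF g] clinear_scale[OF g] scaleC_add_right
          complex_vector.scale_right_diff_distrib scaleC_scaleC mult.commute)
    have "range ?h = {0} \<or> range ?h = UNIV"
    proof (rule irreducible_action_subspace[OF F])
      show "complex_vector.subspace (range ?h)"
      proof (rule complex_vector.subspaceI)
        show "0 \<in> range ?h"
          by (rule range_eqI[of _ _ 0]) (simp add: clinear_zero[OF g])
        fix x y assume "x \<in> range ?h" "y \<in> range ?h"
        then obtain x' y' where "x = ?h x'" "y = ?h y'"
          by blast
        then show "x + y \<in> range ?h"
          by (intro range_eqI[of _ _ "x' + y'"]) (simp only: clinear_add[OF h])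
      next
        fix a x assume "x \<in> range ?h"
        then obtain x' where "x = ?h x'"
          by blast
        then show "a *\<^sub>C x \<in> range ?h"
          by (intro range_eqI[of _ _ "a *\<^sub>C x'"]) (simp only: clinear_scale[OF h])
      qed
      fix f x assume "f \<in> F" "x \<in> range ?h"
      then obtain x' where "x = ?h x'"
        by blast
      with \<open>f \<in> F\<close> show "f x \<in> range ?h"
        by (intro range_eqI[of _ _ "f x'"]) (simp add: clinear_diff[OF Fl] clinear_scale[OF Fl] comm)
    qed
    moreover have "range ?h \<noteq> {0}"
    proof
      assume eq: "range ?h = {0}"
      have "g x = c *\<^sub>C x" for x
        using rangeI[of ?h x] unfolding eq by simp
      with False show False
        by blast
    qed
    ultimately have "y \<in> range ?h"
      by blast
    then show ?thesis
      by blast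
  qed
  \<comment> \<open>On the zero space \<open>g\<close> would be the scalar \<open>0\<close>.\<close>
  obtain v where "v \<noteq> (0 :: 'a)"
  proof -
    have "\<not> (\<forall>x. g x = 0 *\<^sub>C x)"
      using False by blast
    then show ?thesis
      using that clinear_zero[OF g] by auto
  qed
  then show False
    by (rule eigenvalue_or_not_surjective[OF g dim _ inj surj])
qed

text \<open>
  The set of \<open>v\<close> in the kernel, for a minimal family \<open>S\<close>, projects isomorphically onto each
  coordinate, so all coordinates are proportional by Schur's lemma.
\<close>

lemma density:
  fixes T :: "'b::complex_vector \<Rightarrow> 'a::complex_vector \<Rightarrow> 'c::complex_vector"
  assumes dim: "countable_dimension TYPE('a)" and F: "irreducible_action F" and T: "cbilinear T"
    and stable: "\<And>S v f. finite S \<Longrightarrow> (\<Sum>u\<in>S. T u (v u)) = 0 \<Longrightarrow> f \<in> F \<Longrightarrow> (\<Sum>u\<in>S. T u (f (v u))) = 0"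
    and faithful: "\<And>u. (\<And>v. T u v = 0) \<Longrightarrow> u = 0"
    and S: "finite S" "complex_vector.independent S"
    and "(\<Sum>u\<in>S. T u (v u)) = 0" "u \<in> S"
  shows "v u = 0"
  using S assms(8-)
proof (induction "card S" arbitrary: S v u rule: less_induct)
  case less
  note Fl = irreducible_action_clinear[OF F]
  have Tl: "clinear (\<lambda>u. T u v)" and Tr: "clinear (T u)" for u v
    using T by (auto simp: cbilinear_def)
  \<comment> \<open>Relations are functions on the whole type; forcing the value \<open>0\<close>
    off \<open>S\<close> makes them equal as soon as they agree on \<open>S\<close>.\<close>
  define K where "K = {w. (\<forall>x. x \<notin> S \<longrightarrow> w x = 0) \<and> (\<Sum>x\<in>S. T x (w x)) = 0}"
  \<comment> \<open>A relation vanishing at \<open>u\<close> is one over the smaller family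
    \<open>S - {u}\<close>, where the induction hypothesis applies.\<close>
  have K_zero: "w = (\<lambda>_. 0)" if w: "w \<in> K" "w u = 0" for w
  proof
    fix x
    have "(\<Sum>x\<in>S - {u}. T x (w x)) = (\<Sum>x\<in>S. T x (w x))"
      using less.prems w(2) by (simp add: sum.remove[of S u] clinear_zero[OF Tr])
    also have "\<dots> = 0"
      using w by (simp add: K_def)
    finally have sum0: "(\<Sum>x\<in>S - {u}. T x (w x)) = 0" .
    have "w x = 0" if "x \<in> S - {u}"
      using card_Diff1_less[OF less.prems(1,4)] finite_Diff[OF less.prems(1)]
        complex_vector.independent_mono[OF less.prems(2) Diff_subset] sum0 that
      by (rule less.hyps)
    with w show "w x = 0"
      by (auto simp: K_def)
  qed
  have K_add: "(\<lambda>x. w x + w' x) \<in> K" if "w \<in> K" "w' \<in> K" for w w'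
    using that by (simp add: K_def clinear_add[OF Tr] sum.distrib)
  have K_scale: "(\<lambda>x. c *\<^sub>C w x) \<in> K" if "w \<in> K" for c w
    using that by (simp add: K_def clinear_scale[OF Tr] complex_vector.scale_sum_right[symmetric])
  have K_stable: "(\<lambda>x. f (w x)) \<in> K" if "w \<in> K" "f \<in> F" for f w
    using that stable[OF less.prems(1)] by (simp add: K_def clinear_zero[OF Fl])
  have K_unique: "w = w'" if "w \<in> K" "w' \<in> K" "w u = w' u" for w w'
  proof -
    have "(\<lambda>x. w x + (- 1) *\<^sub>C w' x) \<in> K"
      by (intro K_add K_scale that)
    then have "(\<lambda>x. w x + (- 1) *\<^sub>C w' x) = (\<lambda>_. 0)"
      by (rule K_zero) (simp add: that)
    then show ?thesis
      by (simp add: fun_eq_iff)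
  qed
  have "(\<lambda>w. w u) ` K = {0} \<or> (\<lambda>w. w u) ` K = UNIV"
  proof (rule irreducible_action_subspace[OF F])
    have "(\<lambda>_. 0) \<in> K"
      by (simp add: K_def clinear_zero[OF Tr])
    show "complex_vector.subspace ((\<lambda>w. w u) ` K)"
    proof (rule complex_vector.subspaceI)
      show "0 \<in> (\<lambda>w. w u) ` K"
        using \<open>(\<lambda>_. 0) \<in> K\<close> by (rule rev_image_eqI) simp
      fix x y assume "x \<in> (\<lambda>w. w u) ` K" "y \<in> (\<lambda>w. w u) ` K"
      then obtain w w' where "w \<in> K" "x = w u" "w' \<in> K" "y = w' u"
        by (elim imageE)
      then show "x + y \<in> (\<lambda>w. w u) ` K"
        by (intro rev_image_eqI[OF K_add[of w w']]) simp_all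
    next
      fix a x assume "x \<in> (\<lambda>w. w u) ` K"
      then obtain w where "w \<in> K" "x = w u"
        by (elim imageE)
      then show "a *\<^sub>C x \<in> (\<lambda>w. w u) ` K"
        by (intro rev_image_eqI[OF K_scale[of w a]]) simp_all
    qed
    fix f x assume f: "f \<in> F" and "x \<in> (\<lambda>w. w u) ` K"
    then obtain w where "w \<in> K" "x = w u"
      by (elim imageE)
    with f show "f x \<in> (\<lambda>w. w u) ` K"
      by (intro rev_image_eqI[OF K_stable[of w f]]) simp_all
  qed
  then show ?case
  proof
    assume "(\<lambda>w. w u) ` K = {0}"
    moreover have "(\<lambda>x. if x \<in> S then v x else 0) \<in> K"
      using less.prems by (simp add: K_def)
    then have "(\<lambda>w. w u) (\<lambda>x. if x \<in> S then v x else 0) \<in> (\<lambda>w. w u) ` K"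
      by (rule imageI)
    ultimately show ?thesis
      using less.prems(4) by simp
  next
    assume "(\<lambda>w. w u) ` K = UNIV"
    then have "\<exists>w\<in>K. w u = x" for x
      by (metis UNIV_I imageE)
    \<comment> \<open>\<open>w\<close> inverts the projection to coordinate \<open>u\<close>;
      uniqueness makes it linear and compatible with \<open>F\<close>.\<close>
    then obtain w where w: "\<And>x. w x \<in> K" "\<And>x. w x u = x"
      by metis
    have w_add: "w (x + x') = (\<lambda>y. w x y + w x' y)" for x x'
      by (rule K_unique[OF w(1) K_add[OF w(1) w(1)]]) (simp add: w(2))
    have w_scale: "w (c *\<^sub>C x) = (\<lambda>y. c *\<^sub>C w x y)" for c x
      by (rule K_unique[OF w(1) K_scale[OF w(1)]]) (simp add: w(2))
    have w_comm: "w (f x) = (\<lambda>y. f (w x y))" if "f \<in> F" for f x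
      by (rule K_unique[OF w(1) K_stable[OF w(1) that]]) (simp add: w(2))
    have "\<exists>c. \<forall>x. w x y = c *\<^sub>C x" for y
    proof -
      have "clinear (\<lambda>x. w x y)"
        by (simp add: clinear_iff w_add w_scale)
      then show ?thesis
        by (rule schur[OF dim F]) (simp add: w_comm)
    qed
    then obtain c where c: "\<And>x y. w x y = c y *\<^sub>C x"
      by metis
    \<comment> \<open>The relation \<open>w x\<close> collapses to one vector in the left slot.
      Faithfulness and independence give \<open>c u = 0\<close>, whereas
      \<open>c u *\<^sub>C x = w x u = x\<close>.\<close>
    have "T (\<Sum>y\<in>S. c y *\<^sub>C y) x = 0" for x
      using w(1)[of x] by (simp add: K_def c clinear_sum[OF Tl] clinear_scale[OF Tl] clinear_scale[OF Tr])
    then have "(\<Sum>y\<in>S. c y *\<^sub>C y) = 0"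
      by (rule faithful)
    then have "c u = 0"
      using complex_vector.independentD[OF less.prems(2,1)] less.prems(4) by blast
    then show ?thesis
      using w(2)[of "v u"] by (simp add: c)
  qed
qed

section \<open>Tensor products\<close>

lemma
  shows tensor_prod_add_left: "(u + u') \<otimes>\<^sub>t w = u \<otimes>\<^sub>t w + u' \<otimes>\<^sub>t w"
    and tensor_prod_add_right: "u \<otimes>\<^sub>t (w + w') = u \<otimes>\<^sub>t w + u \<otimes>\<^sub>t w'"
    and tensor_prod_scale_left: "(c *\<^sub>C u) \<otimes>\<^sub>t w = c *\<^sub>C (u \<otimes>\<^sub>t w)"
    and tensor_prod_scale_right: "u \<otimes>\<^sub>t (c *\<^sub>C w) = c *\<^sub>C (u \<otimes>\<^sub>t w)"
  by (transfer; unfold tensor_rel_def diff_diff_eq[symmetric];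
      rule complex_vector.span_base; unfold tensor_relations_def; blast)+

lemma tensor_prod_sum_left: "(\<Sum>i\<in>S. h i) \<otimes>\<^sub>t w = (\<Sum>i\<in>S. h i \<otimes>\<^sub>t w)"
  by (rule clinear_sum[of "\<lambda>u. u \<otimes>\<^sub>t w"])
    (simp add: clinear_iff tensor_prod_add_left tensor_prod_scale_left)

lemma tensor_prod_zero_right: "u \<otimes>\<^sub>t 0 = 0"
  using tensor_prod_scale_right[of u 0 0] by simp

text \<open>Finite sums of pure tensors exhaust the space, since scalar coefficients are absorbed
  into the left factor.\<close>

lemma tensor_induct [case_names prod add]:
  assumes prod: "\<And>u w. P (u \<otimes>\<^sub>t w)" and add: "\<And>s t. P s \<Longrightarrow> P t \<Longrightarrow> P (s + t)"
  shows "P t"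
proof -
  obtain x where x: "t = abs_tensor x"
    by (metis Quotient3_abs_rep[OF Quotient3_tensor])
  have single: "abs_tensor (Poly_Mapping.single (u, w) c) = (c *\<^sub>C u) \<otimes>\<^sub>t w" for u :: 'a and w :: 'b and c
  proof -
    have "Poly_Mapping.single (u, w) c = c *\<^sub>C Poly_Mapping.single (u, w) 1"
      by (rule poly_mapping_eqI) (simp add: lookup_single when_def)
    then show ?thesis
      by (simp only: tensor_prod_scale_left) (simp add: tensor_prod.abs_eq scaleC_tensor.abs_eq)
  qed
  have "P (abs_tensor x)"
  proof (induction x rule: update_induct)
    case const
    show ?case
      using prod[of "0" 0] by (simp add: tensor_prod_zero_right zero_tensor_def)
  next
    case (update f k c)
    have "Poly_Mapping.update k c f = f + Poly_Mapping.single k c"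
      using update by (intro poly_mapping_eqI) (auto simp: lookup_update lookup_add lookup_single when_def in_keys_iff)
    then show ?case
      using update add prod single by (cases k) (simp add: plus_tensor.abs_eq[symmetric])
  qed
  with x show ?thesis
    by simp
qed

text \<open>This turns a tensor into a family of right factors indexed by basis vectors, the form in
  which \<open>density\<close> speaks of the kernel.\<close>

lemma tensor_basis_expansion:
  fixes t :: "('a::complex_vector, 'b::complex_vector) tensor"
  assumes "complex_vector.span B = (UNIV :: 'a set)"
  obtains S w where "finite S" "S \<subseteq> B" "t = (\<Sum>b\<in>S. b \<otimes>\<^sub>t w b)"
proof -
  have "\<exists>S w. finite S \<and> S \<subseteq> B \<and> t = (\<Sum>b\<in>S. b \<otimes>\<^sub>t w b)"
  proof (induction t rule: tensor_induct)
    case (prod u x)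
    have "u \<in> complex_vector.span B"
      by (simp add: assms)
    then obtain S r where S: "finite S" "S \<subseteq> B" "u = (\<Sum>b\<in>S. r b *\<^sub>C b)"
      unfolding complex_vector.span_explicit by blast
    then have "u \<otimes>\<^sub>t x = (\<Sum>b\<in>S. b \<otimes>\<^sub>t (r b *\<^sub>C x))"
      by (simp add: tensor_prod_sum_left tensor_prod_scale_left tensor_prod_scale_right)
    with S(1,2) show ?case
      by (intro exI conjI)
  next
    case (add s t)
    from add.IH obtain S w S' w' where *: "finite S" "S \<subseteq> B" "s = (\<Sum>b\<in>S. b \<otimes>\<^sub>t w b)"
        "finite S'" "S' \<subseteq> B" "t = (\<Sum>b\<in>S'. b \<otimes>\<^sub>t w' b)"
      by (elim exE conjE) (rule that)
    have "s = (\<Sum>b\<in>S \<union> S'. b \<otimes>\<^sub>t (if b \<in> S then w b else 0))"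
      unfolding *(3) using * by (intro sum.mono_neutral_cong_left) (auto simp: tensor_prod_zero_right)
    moreover have "t = (\<Sum>b\<in>S \<union> S'. b \<otimes>\<^sub>t (if b \<in> S' then w' b else 0))"
      unfolding *(6) using * by (intro sum.mono_neutral_cong_left) (auto simp: tensor_prod_zero_right)
    ultimately
    have "s + t = (\<Sum>b\<in>S \<union> S'. b \<otimes>\<^sub>t ((if b \<in> S then w b else 0) + (if b \<in> S' then w' b else 0)))"
      by (simp only: tensor_prod_add_right sum.distrib)
    moreover have "finite (S \<union> S')" "S \<union> S' \<subseteq> B"
      using * by auto
    ultimately show ?case
      by (intro exI conjI)
  qed
  then show ?thesis
    by (elim exE conjE) (rule that)
qed

section \<open>Binomial coefficients and sums with finite support\<close>

lemma gbinomial_minus_two: "((- 2 :: complex) gchoose i) = (- 1) ^ i * of_nat (Suc i)"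
proof -
  have "of_nat (Suc i) gchoose i = (of_nat (Suc i) :: complex)"
    by (simp only: binomial_gbinomial[symmetric] binomial_Suc_n)
  then show ?thesis
    using gbinomial_minus[of "2 :: complex" i] by (simp add: add.commute)
qed

lemma Sum_any_single:
  assumes "\<And>i. i \<noteq> k \<Longrightarrow> f i = 0"
  shows "Sum_any f = f k"
  using Sum_any.expand_superset[of "{k}" f] assms by auto

text \<open>On infinite support \<open>Sum_any\<close> takes the default value \<open>0\<close>,
  which lies in \<open>W\<close> as well.\<close>

lemma Sum_any_mem:
  assumes "complex_vector.subspace W" "\<And>i. f i \<in> W"
  shows "Sum_any f \<in> W"
  using assms by (simp add: Sum_any.expand_set complex_vector.subspace_sum)

section \<open>Parity, translation and ideals\<close>

context vertex_superalgebra
begin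

section \<open>Even and odd parts, and the parity involution\<close>

lemmas grading_conjuncts = grading[unfolded internal_direct_sum_def]

lemma subspace_V: "complex_vector.subspace (V \<alpha>)"
  using grading_conjuncts[THEN conjunct1] grading_conjuncts[THEN conjunct2, THEN conjunct1]
  by (cases \<alpha>) simp_all

lemma V_disjoint: "x \<in> V 0 \<Longrightarrow> x \<in> V 1 \<Longrightarrow> x = 0"
  using grading_conjuncts[THEN conjunct2, THEN conjunct2, THEN conjunct1, THEN equalityD1, THEN subsetD, of x]
  by simp

lemma V_decomposition: obtains a b where "a \<in> V 0" "b \<in> V 1" "x = a + b"
proof -
  have "x \<in> {a + b | a b. a \<in> V 0 \<and> b \<in> V 1}"
    using grading_conjuncts[THEN conjunct2, THEN conjunct2, THEN conjunct2, THEN equalityD1]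
    by (rule subsetD) (rule UNIV_I)
  then show ?thesis
    by (elim CollectE exE conjE) (rule that)
qed

definition even_part :: "'v \<Rightarrow> 'v"
  where "even_part x = (THE a. a \<in> V 0 \<and> x - a \<in> V 1)"

definition odd_part :: "'v \<Rightarrow> 'v"
  where "odd_part x = x - even_part x"

definition parity :: "'v \<Rightarrow> 'v"
  where "parity x = even_part x - odd_part x"

lemma even_part_eqI:
  assumes "a \<in> V 0" "b \<in> V 1"
  shows "even_part (a + b) = a"
  unfolding even_part_def
proof (rule the_equality)
  show "a \<in> V 0 \<and> a + b - a \<in> V 1"
    using assms by simp
  fix a' assume a': "a' \<in> V 0 \<and> a + b - a' \<in> V 1"
  have "a + b - a' - b \<in> V 1"
    using a' assms complex_vector.subspace_diff[OF subspace_V] by blast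
  moreover have "a - a' \<in> V 0"
    using a' assms complex_vector.subspace_diff[OF subspace_V] by blast
  ultimately have "a - a' = 0"
    by (intro V_disjoint) simp_all
  then show "a' = a"
    by simp
qed

lemma even_part_in: "even_part x \<in> V 0" and odd_part_in: "odd_part x \<in> V 1"
proof -
  obtain a b where ab: "a \<in> V 0" "b \<in> V 1" "x = a + b"
    by (rule V_decomposition)
  with even_part_eqI[of a b] show "even_part x \<in> V 0" "odd_part x \<in> V 1"
    by (simp_all add: odd_part_def)
qed

lemma even_odd_part: "even_part x + odd_part x = x"
  by (simp add: odd_part_def)

lemma even_part_add: "even_part (x + y) = even_part x + even_part y"
proof -
  have "x + y = (even_part x + even_part y) + (odd_part x + odd_part y)"
    by (simp add: odd_part_def algebra_simps)
  then show ?thesis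
    by (metis even_part_eqI even_part_in odd_part_in complex_vector.subspace_add[OF subspace_V])
qed

lemma even_part_scale: "even_part (c *\<^sub>C x) = c *\<^sub>C even_part x"
proof -
  have "c *\<^sub>C x = c *\<^sub>C even_part x + c *\<^sub>C odd_part x"
    by (simp add: odd_part_def flip: scaleC_add_right)
  then show ?thesis
    by (metis even_part_eqI even_part_in odd_part_in complex_vector.subspace_scale[OF subspace_V])
qed

lemma odd_part_add: "odd_part (x + y) = odd_part x + odd_part y"
  by (simp add: odd_part_def even_part_add)

lemma odd_part_scale: "odd_part (c *\<^sub>C x) = c *\<^sub>C odd_part x"
  by (simp add: odd_part_def even_part_scale complex_vector.scale_right_diff_distrib)

lemma even_part_V0: "x \<in> V 0 \<Longrightarrow> even_part x = x"
  using even_part_eqI[of x 0] complex_vector.subspace_0[OF subspace_V] by simp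

lemma even_part_V1: "x \<in> V 1 \<Longrightarrow> even_part x = 0"
  using even_part_eqI[of 0 x] complex_vector.subspace_0[OF subspace_V] by simp

lemma parity_add: "parity (x + y) = parity x + parity y"
  by (simp add: parity_def even_part_add odd_part_add)

lemma parity_scale: "parity (c *\<^sub>C x) = c *\<^sub>C parity x"
  by (simp add: parity_def even_part_scale odd_part_scale complex_vector.scale_right_diff_distrib)

lemma clinear_parity: "clinear parity"
  by (simp add: clinear_iff parity_add parity_scale)

lemma parity_V0: "x \<in> V 0 \<Longrightarrow> parity x = x"
  by (simp add: parity_def odd_part_def even_part_V0)

lemma parity_V1: "x \<in> V 1 \<Longrightarrow> parity x = - x"
  by (simp add: parity_def odd_part_def even_part_V1)

lemma parity_parity: "parity (parity x) = x"
  by (subst (2) parity_def)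
    (simp add: clinear_diff[OF clinear_parity] parity_V0 parity_V1 even_part_in odd_part_in even_odd_part)

lemma odd_if_parity: "parity x = - x \<Longrightarrow> x \<in> V 1"
proof -
  assume "parity x = - x"
  then have "even_part x + even_part x = 0"
    by (simp add: parity_def odd_part_def)
  then have "(2 :: complex) *\<^sub>C even_part x = 0"
    using scaleC_add_left[of 1 1 "even_part x"] by (simp add: scaleC_one)
  then show ?thesis
    using odd_part_in[of x] by (simp add: odd_part_def)
qed

text \<open>Reduces additive identities to homogeneous vectors, for which the Borcherds identity is
  available.\<close>

lemma homogeneous_induct [case_names homogeneous add]:
  assumes "\<And>\<alpha> u. u \<in> V \<alpha> \<Longrightarrow> P u" "\<And>u u'. P u \<Longrightarrow> P u' \<Longrightarrow> P (u + u')"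
  shows "P u"
  using assms(2)[OF assms(1)[OF even_part_in] assms(1)[OF odd_part_in], of u u]
  by (simp add: even_odd_part)

lemma parity_homogeneous: "u \<in> V \<alpha> \<Longrightarrow> parity u = (if \<alpha> = 0 then u else - u)"
  by (cases \<alpha>) (simp_all add: parity_V0 parity_V1)

lemma Y_minus_left: "Y (- u) n v = - Y u n v" and Y_minus_right: "Y u n (- v) = - Y u n v"
  using Y_scaleC_left[of "- 1" u n v] Y_scaleC_right[of u n "- 1" v] by simp_all

lemma parity_Y: "parity (Y u n v) = Y (parity u) n (parity v)"
proof (induction u rule: homogeneous_induct)
  case u: (homogeneous \<alpha> u)
  show ?case
  proof (induction v rule: homogeneous_induct)
    case v: (homogeneous \<beta> v)
    show ?case
      using Y_graded[OF u v, of n] parity_homogeneous[OF u] parity_homogeneous[OF v]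
      by (cases \<alpha>; cases \<beta>)
        (simp_all add: parity_homogeneous Y_minus_left Y_minus_right)
  qed (simp add: Y_add_right parity_add)
qed (simp add: Y_add_left parity_add)

section \<open>The translation operator\<close>

definition translation :: "'v \<Rightarrow> 'v"
  where "translation u = Y u (- 2) vac"

lemma clinear_translation: "clinear translation"
  unfolding translation_def by (rule Y_linear_left)

text \<open>This is Y(Du, z) = d/dz Y(u, z), from the Borcherds identity for \<open>u\<close>,
  \<open>vac\<close>, \<open>v\<close> with \<open>l = -2\<close>, \<open>m = 0\<close>. Only mode
  -1 of \<open>vac\<close> is nonzero, so the first sum contributes for \<open>n < 0\<close> and the
  second for \<open>n > 0\<close>, by one term each.\<close>

lemma Y_translation: "Y (translation u) n v = (- of_int n) *\<^sub>C Y u (n - 1) v"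
proof (induction u rule: homogeneous_induct)
  case u: (homogeneous \<alpha> u)
  show ?case
  proof (induction v rule: homogeneous_induct)
    case v: (homogeneous \<beta> v)
    have sgn: "super_sign \<alpha> 0 = 1"
      by (simp add: super_sign_def)
    have sq: "(- 1) ^ i * ((- 1) ^ i * c) = (c :: complex)" for i c
      by (simp flip: mult.assoc power_mult_distrib)
    have S3: "Sum_any (\<lambda>i::nat. (of_int 0 gchoose i) *\<^sub>C Y (Y u (- 2 + int i) vac) (0 + n - int i) v)
        = Y (translation u) n v"
      by (subst Sum_any_single[of 0]) (auto simp: gbinomial_0_left scaleC_one translation_def)
    have S1: "Sum_any (\<lambda>i::nat. ((-1) ^ i * (of_int (- 2) gchoose i)) *\<^sub>C Y u (- 2 + 0 - int i) (Y vac (n + int i) v))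
        = (if n < 0 then (- of_int n) *\<^sub>C Y u (n - 1) v else 0)"
      by (subst Sum_any_single[of "nat (- 1 - n)"])
        (auto simp: vacuum Y_zero_right gbinomial_minus_two sq of_nat_nat algebra_simps)
    have S2: "Sum_any (\<lambda>i::nat. ((-1) powi (- 2) * (-1) ^ i * (of_int (- 2) gchoose i)) *\<^sub>C
        Y vac (- 2 + n - int i) (Y u (0 + int i) v))
        = (if n > 0 then of_int n *\<^sub>C Y u (n - 1) v else 0)"
      by (subst Sum_any_single[of "nat (n - 1)"])
        (auto simp: vacuum gbinomial_minus_two sq of_nat_nat algebra_simps)
    have "(if n < 0 then (- of_int n) *\<^sub>C Y u (n - 1) v else 0)
        - (1 :: complex) *\<^sub>C (if n > 0 then of_int n *\<^sub>C Y u (n - 1) v else 0) = Y (translation u) n v"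
      using borcherds_identity[OF u vac_even v, of "- 2" 0 n] unfolding S1 S2 S3 sgn .
    then show ?case
      by (cases n "0 :: int" rule: linorder_cases) (simp_all add: scaleC_one)
  qed (simp add: Y_add_right scaleC_add_right)
qed (simp add: clinear_add[OF clinear_translation] Y_add_left scaleC_add_right)

text \<open>Borcherds identity with third vector \<open>vac\<close>: the second sum dies since
  nonnegative modes kill \<open>vac\<close>; the first keeps the terms with
  \<open>v_{-2} vac\<close> and \<open>v_{-1} vac = v\<close>, the latter being
  \<open>Y (translation u) n v\<close> up to sign.\<close>

lemma translation_Y: "translation (Y u n v) = Y (translation u) n v + Y u n (translation v)"
proof (induction u rule: homogeneous_induct)
  case u: (homogeneous \<alpha> u)
  show ?case
  proof (induction v rule: homogeneous_induct)
    case v: (homogeneous \<beta> v)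
    have S3: "Sum_any (\<lambda>i::nat. (of_int 0 gchoose i) *\<^sub>C Y (Y u (n + int i) v) (0 + (- 2) - int i) vac)
        = translation (Y u n v)"
      by (subst Sum_any_single[of 0]) (auto simp: gbinomial_0_left scaleC_one translation_def)
    have S1: "Sum_any (\<lambda>i::nat. ((-1) ^ i * (of_int n gchoose i)) *\<^sub>C Y u (n + 0 - int i) (Y v (- 2 + int i) vac))
        = Y u n (translation v) - of_int n *\<^sub>C Y u (n - 1) v"
      by (subst Sum_any.expand_superset[of "{0, 1}"])
        (auto simp: creation creation_regular Y_zero_right scaleC_one translation_def intro: ccontr)
    have S2: "Sum_any (\<lambda>i::nat. ((-1) powi n * (-1) ^ i * (of_int n gchoose i)) *\<^sub>C
        Y v (n + (- 2) - int i) (Y u (0 + int i) vac)) = 0"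
      by (simp add: creation_regular Y_zero_right)
    have "Y u n (translation v) - of_int n *\<^sub>C Y u (n - 1) v = translation (Y u n v)"
      using borcherds_identity[OF u v vac_even, of n 0 "- 2"] unfolding S1 S2 S3 by simp
    then show ?case
      by (simp add: Y_translation algebra_simps)
  qed (simp add: Y_add_right clinear_add[OF clinear_translation])
qed (simp add: clinear_add[OF clinear_translation] Y_add_left)

lemma parity_translation: "parity (translation u) = translation (parity u)"
  by (simp add: translation_def parity_Y parity_V0 vac_even)

section \<open>From stable subspaces to ideals\<close>

lemma creation_mode_mem:
  assumes W: "complex_vector.subspace W" "\<And>x. x \<in> W \<Longrightarrow> translation x \<in> W"
  shows "x \<in> W \<Longrightarrow> Y x (- 1 - int i) vac \<in> W"
proof (induction i arbitrary: x)
  case 0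
  then show ?case
    by (simp add: creation)
next
  case (Suc i)
  \<comment> \<open>\<open>x_{-1-i} vac\<close> is \<open>D^i x / i!\<close> with \<open>D\<close>
    the translation; this recursion supplies the next divisor \<open>1 + i\<close>.\<close>
  have eq: "Y (translation x) (- 1 - int i) vac = (1 + of_nat i) *\<^sub>C Y x (- 1 - int (Suc i)) vac"
    by (simp add: Y_translation algebra_simps)
  have "(1 + of_nat i :: complex) \<noteq> 0"
    by (metis of_nat_Suc of_nat_neq_0)
  then have "Y x (- 1 - int (Suc i)) vac = (1 / (1 + of_nat i)) *\<^sub>C Y (translation x) (- 1 - int i) vac"
    by (simp add: eq scaleC_scaleC scaleC_one del: of_nat_Suc)
  then show ?case
    using complex_vector.subspace_scale[OF W(1) Suc.IH[OF W(2)[OF Suc.prems]]] by simp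
qed

text \<open>Skew symmetry expresses \<open>v\<^sub>l u\<close> through \<open>u\<^sub>k v\<close> and powers of the translation operator.\<close>

lemma right_ideal_if_left_ideal:
  assumes W: "complex_vector.subspace W" "\<And>x. x \<in> W \<Longrightarrow> translation x \<in> W"
    and left: "\<And>u n x. x \<in> W \<Longrightarrow> Y u n x \<in> W"
    and v: "v \<in> W" "v \<in> V \<beta>"
  shows "Y v l u \<in> W"
proof (induction u rule: homogeneous_induct)
  case u: (homogeneous \<alpha> u)
  \<comment> \<open>Borcherds identity for \<open>u\<close>, \<open>v\<close>, \<open>vac\<close>
    with \<open>m = -1\<close>, \<open>n = 0\<close>: the first sum vanishes, the second leaves only
    \<open>u_{-1} vac = u\<close>, so \<open>?c\<close> times \<open>Y v l u\<close> is minus a sum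
    of vectors \<open>(u_{l+i} v)_{-1-i} vac\<close> of \<open>W\<close>, up to scalars.\<close>
  let ?c = "super_sign \<alpha> \<beta> * (- 1) powi l"
  have S1: "Sum_any (\<lambda>i::nat. ((-1) ^ i * (of_int l gchoose i)) *\<^sub>C Y u (l + (- 1) - int i) (Y v (0 + int i) vac)) = 0"
    by (simp add: creation_regular Y_zero_right)
  have S2: "Sum_any (\<lambda>i::nat. ((-1) powi l * (-1) ^ i * (of_int l gchoose i)) *\<^sub>C
      Y v (l + 0 - int i) (Y u (- 1 + int i) vac)) = (- 1) powi l *\<^sub>C Y v l u"
    by (subst Sum_any_single[of 0]) (auto simp: creation creation_regular Y_zero_right)
  have S3: "Sum_any (\<lambda>i::nat. (of_int (- 1) gchoose i) *\<^sub>C Y (Y u (l + int i) v) (- 1 + 0 - int i) vac) \<in> W"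
    using creation_mode_mem[OF W left[OF v(1)]]
    by (intro Sum_any_mem[OF W(1)] complex_vector.subspace_scale[OF W(1)]) simp
  have "- (?c *\<^sub>C Y v l u) \<in> W"
    using borcherds_identity[OF u v(2) vac_even, of l "- 1" 0] S3 unfolding S1 S2 by (simp add: scaleC_scaleC)
  then have "?c *\<^sub>C Y v l u \<in> W"
    using complex_vector.subspace_neg[OF W(1)] by fastforce
  then have "(1 / ?c) *\<^sub>C (?c *\<^sub>C Y v l u) \<in> W"
    by (rule complex_vector.subspace_scale[OF W(1)])
  moreover have "?c \<noteq> 0"
    by (simp add: super_sign_def)
  ultimately show ?case
    by (simp only: scaleC_scaleC scaleC_one nonzero_eq_divide_eq[symmetric] divide_self_if if_False times_divide_eq_left mult_1_left)
next
  case (add u u')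
  then show ?case
    by (simp add: Y_add_right complex_vector.subspace_add[OF W(1)])
qed

text \<open>Stability under \<open>parity\<close> yields the grading, since
  \<open>even_part x\<close> is half of \<open>x + parity x\<close>; skew symmetry then applies to
  the even and odd parts separately.\<close>

lemma ideal_if_parity_stable:
  assumes W: "complex_vector.subspace W" "\<And>x. x \<in> W \<Longrightarrow> translation x \<in> W"
    and left: "\<And>u n x. x \<in> W \<Longrightarrow> Y u n x \<in> W"
    and par: "\<And>x. x \<in> W \<Longrightarrow> parity x \<in> W"
  shows "ideal W"
proof -
  have even: "even_part x \<in> W" if "x \<in> W" for x
  proof -
    have "(1 / 2) *\<^sub>C (x + parity x) \<in> W"
      using that par W(1) by (simp add: complex_vector.subspace_scale complex_vector.subspace_add)
    moreover have "x + parity x = (2 :: complex) *\<^sub>C even_part x"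
      using scaleC_add_left[of 1 1 "even_part x"]
      by (simp add: parity_def odd_part_def scaleC_one)
    ultimately show ?thesis
      by (simp add: scaleC_scaleC scaleC_one)
  qed
  have odd: "odd_part x \<in> W" if "x \<in> W" for x
    using that even W(1) by (simp add: odd_part_def complex_vector.subspace_diff)
  have "W \<inter> V 0 \<inter> (W \<inter> V 1) = {0}"
    using V_disjoint complex_vector.subspace_0[OF W(1)] complex_vector.subspace_0[OF subspace_V] by auto
  moreover have "W = {a + b |a b. a \<in> W \<inter> V 0 \<and> b \<in> W \<inter> V 1}"
  proof
    show "W \<subseteq> {a + b |a b. a \<in> W \<inter> V 0 \<and> b \<in> W \<inter> V 1}"
    proof
      fix x assume "x \<in> W"
      then have "even_part x \<in> W \<inter> V 0" "odd_part x \<in> W \<inter> V 1"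
        using even odd even_part_in odd_part_in by simp_all
      then show "x \<in> {a + b |a b. a \<in> W \<inter> V 0 \<and> b \<in> W \<inter> V 1}"
        using even_odd_part[of x, symmetric] by (intro CollectI exI conjI)
    qed
    show "{a + b |a b. a \<in> W \<inter> V 0 \<and> b \<in> W \<inter> V 1} \<subseteq> W"
      using complex_vector.subspace_add[OF W(1)] by (intro subsetI; elim CollectE exE conjE IntE; simp)
  qed
  ultimately have "subsuperspace W"
    unfolding subsuperspace_def internal_direct_sum_def
    by (intro conjI W(1) subspace_V complex_vector.subspace_inter)
  moreover have "Y x n v \<in> W" if "x \<in> W" for x n v
  proof -
    have "Y (even_part x) n v \<in> W" "Y (odd_part x) n v \<in> W"
      using right_ideal_if_left_ideal[OF W left even[OF that] even_part_in]
        right_ideal_if_left_ideal[OF W left odd[OF that] odd_part_in] by simp_all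
    then have "Y (even_part x + odd_part x) n v \<in> W"
      by (simp only: Y_add_left complex_vector.subspace_add[OF W(1)])
    then show ?thesis
      by (simp only: even_odd_part)
  qed
  ultimately show ?thesis
    using left by (simp add: ideal_def)
qed

text \<open>For odd \<open>t\<close> the supercommutator of \<open>t_{-1}\<close> with itself sends
  \<open>vac\<close> to twice \<open>t_{-1} t\<close>, and the Borcherds identity expresses it
  through the \<open>t_i t\<close> with \<open>i \<ge> 0\<close>.\<close>

lemma odd_square_zero:
  assumes t: "t \<in> V 1" and "\<And>n. n \<ge> 0 \<Longrightarrow> Y t n t = 0"
  shows "Y t (- 1) t = 0"
proof -
  have S1: "Sum_any (\<lambda>i::nat. ((-1) ^ i * (of_int 0 gchoose i)) *\<^sub>C Y t (0 + (- 1) - int i) (Y t (- 1 + int i) vac))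
      = Y t (- 1) t"
    by (subst Sum_any_single[of 0]) (auto simp: gbinomial_0_left creation scaleC_one)
  have S2: "Sum_any (\<lambda>i::nat. ((-1) powi 0 * (-1) ^ i * (of_int 0 gchoose i)) *\<^sub>C
      Y t (0 + (- 1) - int i) (Y t (- 1 + int i) vac)) = Y t (- 1) t"
    by (subst Sum_any_single[of 0]) (auto simp: gbinomial_0_left creation scaleC_one)
  have S3: "Sum_any (\<lambda>i::nat. (of_int (- 1) gchoose i) *\<^sub>C Y (Y t (0 + int i) t) (- 1 + (- 1) - int i) vac) = 0"
    by (simp add: assms(2) Y_zero_left)
  have "Y t (- 1) t - (- 1 :: complex) *\<^sub>C Y t (- 1) t = 0"
    using borcherds_identity[OF t t vac_even, of 0 "- 1" "- 1"] unfolding S1 S2 S3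
    by (simp add: super_sign_def)
  then have "(2 :: complex) *\<^sub>C Y t (- 1) t = 0"
    using scaleC_add_left[of 1 1 "Y t (- 1) t"] by (simp add: scaleC_one)
  then show ?thesis
    by simp
qed

text \<open>\<open>translation x\<close> is a mode of \<open>x\<close> applied to
  \<open>vac\<close>, not a mode applied to \<open>x\<close>. It is added because skew symmetry uses
  it to turn left stability into right stability.\<close>

definition mode_operators :: "('v \<Rightarrow> 'v) set"
  where "mode_operators = insert translation {Y u n | u n. True}"

lemma clinear_mode_operators: "f \<in> mode_operators \<Longrightarrow> clinear f"
  using clinear_translation Y_linear_right by (auto simp: mode_operators_def)

end

text \<open>
  A stable subspace \<open>W\<close> need not be graded, but \<open>W \<inter> parity W\<close> and \<open>W + parity W\<close> are. If the former
  is \<open>0\<close> and the latter everything, then \<open>vac / 2 + t \<in> W\<close> for some odd \<open>t\<close>; the graded vectors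
  \<open>t\<^sub>n t = t\<^sub>n (vac / 2 + t)\<close>, \<open>n \<ge> 0\<close>, vanish, hence so does \<open>t\<^sub>-\<^sub>1 t\<close>, and \<open>t / 2 = t\<^sub>-\<^sub>1 (vac / 2 + t) \<in> W\<close>.
\<close>

lemma (in simple_vertex_superalgebra) irreducible_mode_operators:
  "irreducible_action mode_operators"
  unfolding irreducible_action_def
proof (intro conjI ballI allI impI clinear_mode_operators)
  fix W assume W: "complex_vector.subspace W" and stable: "\<forall>f\<in>mode_operators. \<forall>x\<in>W. f x \<in> W"
  note par = parity_add parity_scale parity_parity parity_Y parity_translation
  have tr: "translation x \<in> W" and left: "Y u n x \<in> W" if "x \<in> W" for u n x
    using stable that by (auto simp: mode_operators_def)
  note W_add = complex_vector.subspace_add[OF W] and W_scale = complex_vector.subspace_scale[OF W]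
    and W_0 = complex_vector.subspace_0[OF W]
  define I where "I = {x \<in> W. parity x \<in> W}"
  define S where "S = {x + parity y | x y. x \<in> W \<and> y \<in> W}"
  have S_I: "x + parity y \<in> S" if "x \<in> W" "y \<in> W" for x y
    unfolding S_def using that by blast
  have S_E: "\<exists>x\<in>W. \<exists>y\<in>W. z = x + parity y" if "z \<in> S" for z
    using that unfolding S_def by auto
  have "ideal I"
  proof (rule ideal_if_parity_stable)
    show "complex_vector.subspace I"
      using W_0 W_add W_scale clinear_zero[OF clinear_parity]
      by (intro complex_vector.subspaceI) (simp_all add: I_def par)
  qed (use tr left in \<open>simp_all add: I_def par\<close>)
  then have I: "I = {0} \<or> I = UNIV"
    by (rule simple)
  have "ideal S"
  proof (rule ideal_if_parity_stable)
    show "complex_vector.subspace S"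
    proof (rule complex_vector.subspaceI)
      show "0 \<in> S"
        using S_I[OF W_0 W_0] by (simp add: clinear_zero[OF clinear_parity])
      fix z z' assume "z \<in> S" "z' \<in> S"
      then obtain x y x' y' where *: "x \<in> W" "y \<in> W" "x' \<in> W" "y' \<in> W"
          "z = x + parity y" "z' = x' + parity y'"
        using S_E by meson
      have "z + z' = (x + x') + parity (y + y')"
        by (simp add: * par algebra_simps)
      then show "z + z' \<in> S"
        by (simp only: S_I W_add *(1-4))
    next
      fix c z assume "z \<in> S"
      then obtain x y where *: "x \<in> W" "y \<in> W" "z = x + parity y"
        using S_E by meson
      have "c *\<^sub>C z = c *\<^sub>C x + parity (c *\<^sub>C y)"
        by (simp add: * par scaleC_add_right)
      then show "c *\<^sub>C z \<in> S"
        by (simp only: S_I W_scale *(1,2))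
    qed
  next
    fix z assume "z \<in> S"
    then obtain x y where *: "x \<in> W" "y \<in> W" "z = x + parity y"
      using S_E by meson
    show "translation z \<in> S"
      using S_I[OF tr tr, OF *(1,2)] by (simp add: * clinear_add[OF clinear_translation] par)
    \<comment> \<open>As \<open>parity\<close> is an involutive automorphism,
      \<open>Y u n (parity y)\<close> equals \<open>parity (Y (parity u) n y)\<close>.\<close>
    show "Y u n z \<in> S" for u n
      using S_I[OF left left, OF *(1,2), of u n "parity u" n] by (simp add: * Y_add_right par)
    show "parity z \<in> S"
      using S_I[OF *(2,1)] by (simp add: * par add.commute)
  qed
  then have S: "S = {0} \<or> S = UNIV"
    by (rule simple)
  consider "I = UNIV" | "S = {0}" | "I = {0}" "S = UNIV"
    using I S by argo
  then show "W = {0} \<or> W = UNIV"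
  proof cases
    case 1
    then have "x \<in> I" for x
      by simp
    then have "x \<in> W" for x
      unfolding I_def by simp
    then show ?thesis
      by auto
  next
    case 2
    have "x = 0" if "x \<in> W" for x
      using S_I[OF that W_0] unfolding 2 by (simp add: clinear_zero[OF clinear_parity])
    with W_0 show ?thesis
      by auto
  next
    case 3
    have I_zero: "x = 0" if "x \<in> W" "parity x \<in> W" for x
    proof -
      have "x \<in> I"
        using that by (simp add: I_def)
      then show ?thesis
        by (simp add: 3)
    qed
    have pvac: "parity vac = vac"
      by (rule parity_V0[OF vac_even])
    have half: "(1 / 2) *\<^sub>C x + (1 / 2) *\<^sub>C x = x" for x :: 'a
      by (simp add: scaleC_one flip: scaleC_add_left)
    have "vac \<in> S"
      by (simp add: 3)
    then obtain x y where xy: "x \<in> W" "y \<in> W" "vac = x + parity y"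
      using S_E by meson
    have "parity (x + parity y) = x + parity y"
      using pvac by (simp only: xy(3))
    then have xy': "vac = parity x + y"
      by (simp only: parity_add parity_parity xy(3))
    \<comment> \<open>Averaging the two expressions for \<open>vac\<close> yields a vector of
      \<open>W\<close> with \<open>w + parity w = vac\<close>.\<close>
    define w where "w = (1 / 2) *\<^sub>C (x + y)"
    define t where "t = w - (1 / 2) *\<^sub>C vac"
    have w: "w \<in> W"
      unfolding w_def by (intro W_scale W_add xy)
    have "w + parity w = (1 / 2) *\<^sub>C ((x + parity y) + (parity x + y))"
      by (simp add: w_def par scaleC_add_right algebra_simps)
    also have "\<dots> = vac"
      unfolding xy(3)[symmetric] xy'[symmetric] by (simp only: scaleC_add_right half)
    finally have pw: "parity w = vac - w"
      by (simp add: algebra_simps)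
    have pt: "parity t = - t"
    proof -
      have "parity t = (1 / 2) *\<^sub>C vac + (1 / 2) *\<^sub>C vac - w - (1 / 2) *\<^sub>C vac"
        by (simp only: half) (simp add: t_def clinear_diff[OF clinear_parity] par pvac pw)
      then show ?thesis
        by (simp add: t_def)
    qed
    have t: "t \<in> V 1"
      by (rule odd_if_parity[OF pt])
    have w_t: "w = t + (1 / 2) *\<^sub>C vac"
      by (simp add: t_def)
    have "Y t n t = 0" if "n \<ge> 0" for n
    proof (rule I_zero)
      have "Y t n t = Y t n w"
        using that by (simp add: w_t Y_add_right Y_scaleC_right creation_regular)
      then show "Y t n t \<in> W"
        using left[OF w] by simp
      then show "parity (Y t n t) \<in> W"
        by (simp add: par pt Y_minus_left Y_minus_right)
    qed
    then have "Y t (- 1) t = 0"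
      by (rule odd_square_zero[OF t])
    then have "Y t (- 1) w = (1 / 2) *\<^sub>C t"
      by (simp add: w_t Y_add_right Y_scaleC_right creation)
    then have "2 *\<^sub>C ((1 / 2) *\<^sub>C t) \<in> W"
      using left[OF w, of t "- 1"] by (simp only: W_scale)
    then have tW: "t \<in> W"
      by (simp add: scaleC_scaleC scaleC_one)
    then have "t = 0"
      using complex_vector.subspace_neg[OF W] by (intro I_zero) (simp_all add: pt)
    \<comment> \<open>Now \<open>w\<close> is half of \<open>vac\<close>, so \<open>vac\<close> is
      an even vector of \<open>W\<close> and vanishes; the whole space is then zero, as
      \<open>vac_{-1}\<close> is the identity.\<close>
    then have "2 *\<^sub>C ((1 / 2) *\<^sub>C vac) \<in> W"
      using w by (simp only: W_scale w_t add_0_left)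
    then have "vac \<in> W"
      by (simp add: scaleC_scaleC scaleC_one)
    then have "vac = 0"
      by (intro I_zero) (simp_all add: pvac)
    then have "x = 0" for x :: 'a
      using vacuum[of "- 1" x] by (simp add: Y_zero_left)
    then show ?thesis
      using W_0 by auto
  qed
qed

section \<open>Locality and the kernel of the twisted map\<close>

context vertex_superalgebra
begin

text \<open>Once \<open>k\<close> exceeds the truncation bound of Y(a, z) u, the iterate side of the
  Borcherds identity with \<open>l = k\<close> vanishes. The bound is uniform in \<open>m\<close>,
  \<open>n\<close>, \<open>v\<close>, and holding for all larger \<open>k\<close> lets several
  bounds be merged by a maximum.\<close>

lemma locality:
  assumes a: "a \<in> V \<alpha>" and u: "u \<in> V \<beta>"
  shows "\<exists>K. \<forall>k\<ge>K. \<forall>m n v. (\<Sum>j\<le>k. ((- 1) ^ j * of_nat (k choose j)) *\<^sub>C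
    (Y a (m + int k - int j) (Y u (n + int j) v)
      - super_sign \<alpha> \<beta> *\<^sub>C Y u (n + int j) (Y a (m + int k - int j) v))) = 0"
proof -
  obtain N where N: "\<forall>n\<ge>N. Y a n u = 0"
    using truncation by (rule exE)
  have "(\<Sum>j\<le>k. ((- 1) ^ j * of_nat (k choose j)) *\<^sub>C
    (Y a (m + int k - int j) (Y u (n + int j) v)
      - super_sign \<alpha> \<beta> *\<^sub>C Y u (n + int j) (Y a (m + int k - int j) v))) = 0"
    if k: "k \<ge> nat N" for k m n v
  proof (induction v rule: homogeneous_induct)
    case v: (homogeneous \<gamma> v)
    have gb: "(of_int (int k) gchoose i) = (of_nat (k choose i) :: complex)" for i
      by (simp add: binomial_gbinomial)
    have S1: "Sum_any (\<lambda>i::nat. ((-1) ^ i * (of_int (int k) gchoose i)) *\<^sub>C Y a (int k + m - int i) (Y u (n + int i) v))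
        = (\<Sum>j\<le>k. ((- 1) ^ j * of_nat (k choose j)) *\<^sub>C Y a (m + int k - int j) (Y u (n + int j) v))"
      unfolding gb by (subst Sum_any.expand_superset[of "{..k}"])
        (simp, rule subsetI, rule ccontr, simp, simp add: add.commute)
    have "Sum_any (\<lambda>i::nat. ((-1) powi (int k) * (-1) ^ i * (of_int (int k) gchoose i)) *\<^sub>C
        Y u (int k + n - int i) (Y a (m + int i) v))
        = (\<Sum>i\<le>k. ((-1) powi (int k) * (-1) ^ i * of_nat (k choose i)) *\<^sub>C
        Y u (int k + n - int i) (Y a (m + int i) v))"
      unfolding gb by (subst Sum_any.expand_superset[of "{..k}"]) (simp, rule subsetI, rule ccontr, simp, simp)
    \<comment> \<open>Reversing the summation turns the sign \<open>(-1)^k (-1)^i\<close> into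
      \<open>(-1)^(k-i)\<close> and aligns the modes with those of the first sum.\<close>
    also have "\<dots> = (\<Sum>j\<le>k. ((- 1) ^ j * of_nat (k choose j)) *\<^sub>C Y u (n + int j) (Y a (m + int k - int j) v))"
    proof (rule sum.reindex_bij_witness[of _ "\<lambda>j. k - j" "\<lambda>j. k - j"])
      fix i assume i: "i \<in> {..k}"
      have "(- 1 :: complex) powi (int k) * (- 1) ^ i = (- 1) ^ (k - i)"
        using i by (simp add: minus_one_power_iff)
      moreover have "k choose i = k choose (k - i)"
        using i by (intro binomial_symmetric) simp
      moreover have "int k + n - int i = n + int (k - i)" "m + int i = m + int k - int (k - i)"
        using i by auto
      ultimately show "((- 1) ^ (k - i) * of_nat (k choose (k - i))) *\<^sub>C Y u (n + int (k - i)) (Y a (m + int k - int (k - i)) v)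
        = ((-1) powi (int k) * (-1) ^ i * of_nat (k choose i)) *\<^sub>C Y u (int k + n - int i) (Y a (m + int i) v)"
        by (simp only:)
    qed auto
    finally have S2: "Sum_any (\<lambda>i::nat. ((-1) powi (int k) * (-1) ^ i * (of_int (int k) gchoose i)) *\<^sub>C
        Y u (int k + n - int i) (Y a (m + int i) v))
        = (\<Sum>j\<le>k. ((- 1) ^ j * of_nat (k choose j)) *\<^sub>C Y u (n + int j) (Y a (m + int k - int j) v))" .
    have "Y a (int k + int i) u = 0" for i
      using k by (intro N[rule_format]) simp
    then have S3: "Sum_any (\<lambda>i::nat. (of_int m gchoose i) *\<^sub>C Y (Y a (int k + int i) u) (m + n - int i) v) = 0"
      by (simp add: Y_zero_left)
    show ?case
      using borcherds_identity[OF a u v, of "int k" m n] unfolding S1 S2 S3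
      by (simp add: complex_vector.scale_right_diff_distrib sum_subtractf complex_vector.scale_sum_right
          scaleC_scaleC mult.commute mult.left_commute)
  next
    case (add v v')
    have split: "A + A' - s *\<^sub>C (B + B') = (A - s *\<^sub>C B) + (A' - s *\<^sub>C B')" for A A' B B' :: 'v and s
      by (simp add: scaleC_add_right)
    show ?case
      unfolding Y_add_right split unfolding scaleC_add_right[of _ "_ - _"] sum.distrib add by simp
  qed
  then show ?thesis
    by (intro exI[of _ "nat N"] allI impI)
qed

text \<open>
  Composing odd operators with the parity map turns supercommutators into commutators, so that the
  kernel of the twisted map is stable under the untwisted modes acting on the right tensor factor.
\<close>

definition twisted :: "'v \<Rightarrow> int \<Rightarrow> 'v \<Rightarrow> 'v"
  where "twisted u n v = Y (even_part u) n v + Y (odd_part u) n (parity v)"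

lemma twisted_V0: "u \<in> V 0 \<Longrightarrow> twisted u n v = Y u n v"
  and twisted_V1: "u \<in> V 1 \<Longrightarrow> twisted u n v = Y u n (parity v)"
  by (simp_all add: twisted_def odd_part_def even_part_V0 even_part_V1 Y_zero_left)

lemma twisted_add_left: "twisted (u + u') n v = twisted u n v + twisted u' n v"
  by (simp add: twisted_def even_part_add odd_part_add Y_add_left)

text \<open>Moving \<open>parity\<close> past an odd mode costs a factor -1, exactly the sign in the
  supercommutator of two odd fields; what remains is an ordinary commutator.\<close>

lemma twisted_locality:
  "\<exists>K. \<forall>k\<ge>K. \<forall>m n v. (\<Sum>j\<le>k. ((- 1) ^ j * of_nat (k choose j)) *\<^sub>C
    (Y a (m + int k - int j) (twisted u (n + int j) v)
      - twisted u (n + int j) (Y a (m + int k - int j) v))) = 0"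
    (is "\<exists>K. ?P a u K")
proof (induction u rule: homogeneous_induct)
  case u: (homogeneous \<beta> u)
  show ?case
  proof (induction a rule: homogeneous_induct)
    case a: (homogeneous \<alpha> a)
    obtain K where K: "\<And>k m n v. k \<ge> K \<Longrightarrow> (\<Sum>j\<le>k. ((- 1) ^ j * of_nat (k choose j)) *\<^sub>C
      (Y a (m + int k - int j) (Y u (n + int j) v)
        - super_sign \<alpha> \<beta> *\<^sub>C Y u (n + int j) (Y a (m + int k - int j) v))) = 0"
      using locality[OF a u] by blast
    have eq: "Y a p (twisted u q v) - twisted u q (Y a p v)
      = Y a p (Y u q v') - super_sign \<alpha> \<beta> *\<^sub>C Y u q (Y a p v')"
      if "v' = (if \<beta> = 0 then v else parity v)" for p q v v'
      using u a that
      by (cases \<beta>; cases \<alpha>)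
        (simp_all add: twisted_V0 twisted_V1 parity_Y parity_V0 parity_V1 super_sign_def scaleC_one
          Y_minus_left Y_minus_right)
    have "?P a u K"
      using K by (simp only: eq[OF refl]) simp
    then show ?case
      by blast
  next
    case (add a a')
    then obtain K K' where K: "?P a u K" "?P a' u K'"
      by blast
    have split: "Y (a + a') p x - twisted u q (Y (a + a') p v)
      = (Y a p x - twisted u q (Y a p v)) + (Y a' p x - twisted u q (Y a' p v))" for p q x v
      by (simp add: twisted_def parity_add Y_add_left Y_add_right)
    have "?P (a + a') u (max K K')"
      unfolding split scaleC_add_right sum.distrib using K by simp
    then show ?case
      by blast
  qed
next
  case (add u u')
  then obtain K K' where K: "?P a u K" "?P a u' K'"
    by blast
  have split: "Y a p (twisted (u + u') q v) - twisted (u + u') q x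
    = (Y a p (twisted u q v) - twisted u q x) + (Y a p (twisted u' q v) - twisted u' q x)" for p q x v
    by (simp add: twisted_add_left Y_add_right)
  have "?P a (u + u') (max K K')"
    unfolding split scaleC_add_right sum.distrib using K by simp
  then show ?case
    by blast
qed

section \<open>Stability of the twisted kernel\<close>

lemma twisted_zero_right: "twisted u n 0 = 0"
  by (simp add: twisted_def Y_zero_right clinear_zero[OF clinear_parity])

text \<open>Summed over \<open>S\<close>, locality loses the terms where \<open>a\<close> acts last
  and becomes a recurrence for \<open>F\<close>. Its term \<open>j = k\<close> has the lowest
  \<open>m\<close>, and \<open>F\<close> vanishes for large \<open>m\<close>, so descending
  induction on \<open>m\<close> kills \<open>F\<close>.\<close>

lemma twisted_kernel_mode:
  assumes S: "finite S" and ker: "\<And>n. (\<Sum>u\<in>S. twisted u n (v u)) = 0"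
  shows "(\<Sum>u\<in>S. twisted u n (Y a m (v u))) = 0"
proof -
  define F where "F n m = (\<Sum>u\<in>S. twisted u n (Y a m (v u)))" for n m
  have "\<forall>u. \<exists>M. \<forall>m\<ge>M. Y a m (v u) = 0"
    using truncation by blast
  from choice[OF this] obtain M where M: "\<And>u m. m \<ge> M u \<Longrightarrow> Y a m (v u) = 0"
    by blast
  \<comment> \<open>Inserting \<open>0\<close> keeps the maximum defined for empty
    \<open>S\<close>.\<close>
  define M0 where "M0 = Max (insert 0 (M ` S))"
  have M0: "M u \<le> M0" if "u \<in> S" for u
    using that S by (simp add: M0_def)
  have high: "F n m = 0" if "m \<ge> M0" for n m
    unfolding F_def using M M0 that by (intro sum.neutral) (force simp: twisted_zero_right)
  define loc where "loc u K \<longleftrightarrow> (\<forall>k\<ge>K. \<forall>m n v. (\<Sum>j\<le>k. ((- 1) ^ j * of_nat (k choose j)) *\<^sub>C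
    (Y a (m + int k - int j) (twisted u (n + int j) v)
      - twisted u (n + int j) (Y a (m + int k - int j) v))) = 0)" for u K
  have "\<forall>u. \<exists>K. loc u K"
    unfolding loc_def by (intro allI twisted_locality)
  from choice[OF this] obtain K where K: "\<forall>u. loc u (K u)"
    by (rule exE)
  define k where "k = Max (insert 0 (K ` S))"
  have k: "K u \<le> k" if "u \<in> S" for u
    using that S by (simp add: k_def)
  have rec: "(\<Sum>j\<le>k. ((- 1) ^ j * of_nat (k choose j)) *\<^sub>C F (n + int j) (m + int k - int j)) = 0" for n m
  proof -
    let ?c = "\<lambda>j. (- 1) ^ j * of_nat (k choose j) :: complex"
    have "(\<Sum>u\<in>S. \<Sum>j\<le>k. ?c j *\<^sub>C (Y a (m + int k - int j) (twisted u (n + int j) (v u))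
      - twisted u (n + int j) (Y a (m + int k - int j) (v u)))) = 0"
      using K k unfolding loc_def by (intro sum.neutral) simp
    also have "(\<Sum>u\<in>S. \<Sum>j\<le>k. ?c j *\<^sub>C (Y a (m + int k - int j) (twisted u (n + int j) (v u))
      - twisted u (n + int j) (Y a (m + int k - int j) (v u))))
      = (\<Sum>j\<le>k. ?c j *\<^sub>C (\<Sum>u\<in>S. Y a (m + int k - int j) (twisted u (n + int j) (v u))
      - twisted u (n + int j) (Y a (m + int k - int j) (v u))))"
      by (subst sum.swap) (simp add: complex_vector.scale_sum_right)
    also have "\<dots> = (\<Sum>j\<le>k. ?c j *\<^sub>C (- F (n + int j) (m + int k - int j)))"
      by (simp add: sum_subtractf F_def ker Y_zero_right flip: clinear_sum[OF Y_linear_right])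
    finally show ?thesis
      by (simp add: sum_negf)
  qed
  have "F n m = 0" for n m
  \<comment> \<open>Shifting \<open>n\<close> by \<open>k\<close> makes the term
    \<open>j = k\<close> equal to \<open>F n m\<close> up to sign.\<close>
  proof (induction "nat (M0 - m)" arbitrary: n m rule: less_induct)
    case less
    show ?case
    proof (cases "m \<ge> M0")
      case False
      let ?t = "\<lambda>j. ((- 1) ^ j * of_nat (k choose j) :: complex) *\<^sub>C F (n - int k + int j) (m + int k - int j)"
      have "?t j = 0" if "j \<in> {..k} - {k}" for j
        using less[of "m + int k - int j"] that False by auto
      then have "(\<Sum>j\<le>k. ?t j) = ?t k"
        by (simp add: sum.remove[of "{..k}" k])
      then show ?thesis
        using rec[of "n - int k" m] by simp
    qed (rule high)
  qed
  then show ?thesis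
    by (simp add: F_def)
qed

lemma twisted_translation:
  "twisted u n (translation v) = translation (twisted u n v) + of_int n *\<^sub>C twisted u (n - 1) v"
  by (simp add: twisted_def parity_translation clinear_add[OF clinear_translation] translation_Y
      Y_translation scaleC_add_right)

text \<open>Translation changes a coefficient only by multiples of another coefficient of the same
  vanishing series.\<close>

lemma twisted_kernel_translation:
  assumes "\<And>n. (\<Sum>u\<in>S. twisted u n (v u)) = 0"
  shows "(\<Sum>u\<in>S. twisted u n (translation (v u))) = 0"
  by (simp add: twisted_translation sum.distrib assms clinear_zero[OF clinear_translation]
      flip: clinear_sum[OF clinear_translation] complex_vector.scale_sum_right)

section \<open>Twisted Laurent series and homogeneous bases\<close>

definition twisted_laurent :: "'v \<Rightarrow> 'v \<Rightarrow> 'v fls"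
  where "twisted_laurent u v = Y_laurent Y (even_part u) v + Y_laurent Y (odd_part u) (parity v)"

lemma nth_twisted_laurent: "fls_nth (twisted_laurent u v) k = twisted u (- k - 1) v"
  by (simp add: twisted_laurent_def twisted_def nth_Y_laurent)

lemma cbilinear_twisted_laurent: "cbilinear twisted_laurent"
  unfolding cbilinear_def clinear_iff
  by (intro conjI allI fls_eqI)
    (simp_all add: nth_twisted_laurent twisted_def even_part_add odd_part_add even_part_scale odd_part_scale
      parity_add parity_scale Y_add_left Y_scaleC_left Y_add_right Y_scaleC_right scaleC_add_right)

lemma sum_twisted_laurent_eq_0_iff:
  "(\<Sum>u\<in>S. twisted_laurent u (v u)) = 0 \<longleftrightarrow> (\<forall>n. (\<Sum>u\<in>S. twisted u n (v u)) = 0)"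
proof -
  have "(\<Sum>u\<in>S. twisted_laurent u (v u)) = 0 \<longleftrightarrow> (\<forall>k. (\<Sum>u\<in>S. twisted u (- k - 1) (v u)) = 0)"
    by (simp add: fls_eq_iff fls_nth_sum nth_twisted_laurent)
  also have "\<dots> \<longleftrightarrow> (\<forall>n. (\<Sum>u\<in>S. twisted u n (v u)) = 0)"
  proof (intro iffI allI)
    fix n assume "\<forall>k. (\<Sum>u\<in>S. twisted u (- k - 1) (v u)) = 0"
    from spec[OF this, of "- n - 1"] show "(\<Sum>u\<in>S. twisted u n (v u)) = 0"
      by simp
  qed simp
  finally show ?thesis .
qed

text \<open>A maximal independent set of homogeneous vectors spans both summands. Homogeneity lets
  the twist be undone term by term in an expansion.\<close>

lemma homogeneous_basis:
  obtains B where "B \<subseteq> V 0 \<union> V 1" "complex_vector.independent B" "complex_vector.span B = UNIV"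
proof -
  obtain B where B: "B \<subseteq> V 0 \<union> V 1" "complex_vector.independent B" "V 0 \<union> V 1 \<subseteq> complex_vector.span B"
    by (rule complex_vector.maximal_independent_subset)
  have "x \<in> complex_vector.span B" for x
  proof -
    have "even_part x \<in> complex_vector.span B" "odd_part x \<in> complex_vector.span B"
      using B(3) even_part_in odd_part_in by auto
    then have "even_part x + odd_part x \<in> complex_vector.span B"
      by (rule complex_vector.span_add)
    then show ?thesis
      by (simp only: even_odd_part)
  qed
  then have "complex_vector.span B = UNIV"
    by auto
  with B(1,2) show ?thesis
    by (rule that)
qed

end

text \<open>\<open>density\<close> for the twisted map; faithfulness comes from
  \<open>u_{-1} vac = u\<close>, where the twist is invisible because \<open>vac\<close> is
  even.\<close>

lemma (in simple_vertex_superalgebra) twisted_laurent_injective: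
  assumes "countable_dimension TYPE('a)" "finite S" "complex_vector.independent S"
    and "(\<Sum>u\<in>S. twisted_laurent u (v u)) = 0" "u \<in> S"
  shows "v u = 0"
proof (rule density[OF assms(1) irreducible_mode_operators cbilinear_twisted_laurent _ _ assms(2-5)])
  show "(\<Sum>u\<in>S. twisted_laurent u (f (v u))) = 0"
    if "finite S" "(\<Sum>u\<in>S. twisted_laurent u (v u)) = 0" "f \<in> mode_operators" for S v f
    using that unfolding sum_twisted_laurent_eq_0_iff mode_operators_def
    by (auto intro: twisted_kernel_mode twisted_kernel_translation)
  show "u = 0" if "\<And>v. twisted_laurent u v = 0" for u
  proof -
    have "twisted u (- 1) vac = 0"
      using nth_twisted_laurent[of u vac 0] by (simp add: that)
    then show ?thesis
      by (simp add: twisted_def parity_V0[OF vac_even] creation even_odd_part)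
  qed
qed

theorem theorem3p5:
  fixes V :: "bit \<Rightarrow> 'v::complex_vector set"
    and Y :: "'v \<Rightarrow> int \<Rightarrow> 'v \<Rightarrow> 'v"
    and vac :: 'v
  assumes "simple_vertex_superalgebra V Y vac"
    and "countable_dimension TYPE('v)"
  shows "inj (Y_tensor Y)"
proof -
  interpret simple_vertex_superalgebra V Y vac
    by (fact assms(1))
  have kernel: "t = 0" if "Y_tensor Y t = 0" for t
  proof -
    obtain B where B: "B \<subseteq> V 0 \<union> V 1" "complex_vector.independent B" "complex_vector.span B = UNIV"
      by (rule homogeneous_basis)
    obtain S w where S: "finite S" "S \<subseteq> B" and t: "t = (\<Sum>b\<in>S. b \<otimes>\<^sub>t w b)"
      by (rule tensor_basis_expansion[OF B(3)])
    \<comment> \<open>For odd \<open>b\<close> the twisted map inserts a \<open>parity\<close>,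
      which a second one cancels; thus the twisted relation in \<open>w'\<close> is the given one in
      \<open>w\<close>.\<close>
    define w' where "w' b = (if b \<in> V 0 then w b else parity (w b))" for b
    have "twisted_laurent b (w' b) = Y_laurent Y b (w b)" if "b \<in> S" for b
    proof -
      have "b \<in> V 0 \<or> b \<in> V 1"
        using that S B by blast
      then show ?thesis
        by (intro fls_eqI)
          (auto simp: nth_twisted_laurent nth_Y_laurent w'_def twisted_V0 twisted_V1 parity_parity)
    qed
    then have "(\<Sum>b\<in>S. twisted_laurent b (w' b)) = 0"
      using that by (simp add: t clinear_sum[OF clinear_Y_tensor] Y_tensor_prod)
    then have "w' b = 0" if "b \<in> S" for b
      using twisted_laurent_injective[OF assms(2) S(1) complex_vector.independent_mono[OF B(2) S(2)]] that
      by blast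
    then have "w b = 0" if "b \<in> S" for b
      using that unfolding w'_def by (metis parity_parity clinear_zero[OF clinear_parity])
    then show ?thesis
      by (simp add: t tensor_prod_zero_right)
  qed
  show ?thesis
  proof (rule injI)
    fix s t assume "Y_tensor Y s = Y_tensor Y t"
    then have "Y_tensor Y (s - t) = 0"
      by (simp add: clinear_diff[OF clinear_Y_tensor])
    then show "s = t"
      using kernel by fastforce
  qed
qed

end
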